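(* Let $C/\mathbb Q$ be the affine curve defined by $y^2=2(x^3+x^2-x+1)$, $z^2=-2(x^3-x^2-x-1)$. Then: (1) $C(\mathbb Q)=\{(\pm1,\pm2,\pm2)\}$ (all sign choices); (2) if $K$ is a quadratic field different from $\mathbb Q(\sqrt2)$ and $\mathbb Q(\sqrt{-7})$, then $C(K)=C(\mathbb Q)$; (3) for $K=\mathbb Q(\sqrt2)$, $C(K)\setminus C(\mathbb Q)=\{(0,\pm\sqrt2,\pm\sqrt2)\}$; (4) for $K=\mathbb Q(\sqrt{-7})$, $C(K)\setminus C(\mathbb Q)$ consists of the points $(x,\pm(2x-4),\pm(2x+4))$ with $x^2+7=0$.
   Context: For a field $K\supseteq\mathbb Q$, $C(K)$ denotes the set of triples $(x,y,z)\in K^3$ satisfying both equations. *)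

theory Defs
  imports Complex_Main
begin

text \<open>
  Fields containing the rational numbers are represented as subfields of an arbitrary ambient
  field of characteristic 0, given by a type \<open>'a :: field_char_0\<close>. The ambient field is not
  required to be algebraically closed: \<open>K = UNIV\<close> is allowed, and so is \<open>'a = complex\<close>.
  The rational numbers inside the ambient field are the library's \<open>\<rat> :: 'a set\<close>.
\<close>

definition is_subfield :: "'a::field set \<Rightarrow> bool" where
  "is_subfield K \<longleftrightarrow>
     0 \<in> K \<and> 1 \<in> K \<and>
     (\<forall>a\<in>K. \<forall>b\<in>K. a + b \<in> K \<and> a * b \<in> K) \<and>
     (\<forall>a\<in>K. - a \<in> K \<and> inverse a \<in> K)"

text \<open>
  The degree of \<open>K\<close> over the rationals. The library's \<open>dim\<close> is \<open>0\<close> for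
  infinite-dimensional spaces, so a positive value is a genuine finite degree.
\<close>

definition rat_degree :: "'a::field_char_0 set \<Rightarrow> nat" where
  "rat_degree K = vector_space.dim (\<lambda>(q::rat) (x::'a). of_rat q * x) K"

definition quadratic_field :: "'a::field_char_0 set \<Rightarrow> bool" where
  "quadratic_field K \<longleftrightarrow> is_subfield K \<and> rat_degree K = 2"

text \<open>
  \<open>\<rat>(s)\<close>, the smallest subfield containing \<open>s\<close>; it contains \<open>\<rat>\<close> as every subfield does.
\<close>

definition rat_adjoin :: "'a::field_char_0 \<Rightarrow> 'a set" where
  "rat_adjoin s = is_subfield hull {s}"

definition curve_points :: "'a::field_char_0 set \<Rightarrow> ('a \<times> 'a \<times> 'a) set" where
  "curve_points K =
     {(x, y, z). x \<in> K \<and> y \<in> K \<and> z \<in> K \<and>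
        y\<^sup>2 = 2 * (x ^ 3 + x\<^sup>2 - x + 1) \<and>
        z\<^sup>2 = - 2 * (x ^ 3 - x\<^sup>2 - x - 1)}"

end

(*
  Both coordinates y and z give points on copies of the elliptic curve y^2 = 2(x^3 + x^2 - x + 1),
  and the product yz gives, in s = 1/x^2, points on w^2 = s^3 + s^2 + 3s - 1.  If eta is the real
  root of t^3 = t^2 + t + 1, the two cubics are norms of 2(x + eta) (up to squares) and s eta^2 - 1
  from Q(eta).  A 2-descent shows that these elements are squares in Q(eta) at every rational
  point, so every rational point is a double, and an infinite descent on denominators leaves only
  x = 1, -1 and s = 1.  The 2-descent needs neither the class number nor reduction theory of
  quartics: given al in Z[eta] of norm m^2, the lattice (m, al) contains a vector b, short in the
  metric twisted by 1/al, for which b^2/al is an integer of norm less than 4, hence a unit, and the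
  units of norm 1 are the powers of eta.

  A point with irrational x in a quadratic field has y = a + b x with rational a, b; the third
  intersection point of this line with the elliptic curve is rational, hence known.  Doing the same
  for z and comparing the two quadratic equations for x leaves only x^2 = -7.  If x is rational
  but y and z are not, then z is a rational multiple of y, and the second curve gives x = 0.
*)

theory Submission
  imports Defs "HOL-Analysis.Analysis" "HOL-Computational_Algebra.Nth_Powers"
begin

text \<open>The cubic field has one real and one pair of complex embeddings and discriminant -44.
  The ideal \<open>(m, al)\<close> has index at most \<open>|m|\<close> while \<open>al\<close> has
  norm \<open>m^2\<close>, so the twist by \<open>1/al\<close> removes \<open>m\<close> and the Gram
  determinant is 44 for every point. The resulting norm bound stays just below 4, and since the norm
  of \<open>b^2/al\<close> is a square, it must be 1. Only the square classes of 1 and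
  \<open>eta\<close> remain, and the second is excluded by parity of coordinates.

  Halving a point need not lower its denominator. It can stall only when a cubic form takes a small
  value (\<open>g11 p q = 2\<close>, \<open>c44 j l = 1\<close>). Solving these Thue equations is
  avoided by comparing real positions: a stalled halving confines the starting point to one side of
  0 or of 1, and a second stalled halving then gives a contradiction or the known point.

  The ambient field carries no order and may contain a square root of -1, so arguments about signs
  or sums of squares are moved to \<open>rat\<close>.\<close>

section \<open>The ring \<open>Z[eta]\<close> with \<open>eta^3 = eta^2 + eta + 1\<close>\<close>

text \<open>
  \<open>Trib a b c\<close> represents \<open>a + b eta + c eta^2\<close>.
\<close>

datatype trib = Trib (c0: int) (c1: int) (c2: int)

instantiation trib :: comm_ring_1
begin

definition "0 = Trib 0 0 0"
definition "1 = Trib 1 0 0"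
definition "x + y = Trib (c0 x + c0 y) (c1 x + c1 y) (c2 x + c2 y)"
definition "- x = Trib (- c0 x) (- c1 x) (- c2 x)"
definition "x - y = Trib (c0 x - c0 y) (c1 x - c1 y) (c2 x - c2 y)"
text \<open>The reduction uses \<open>eta^3 = eta^2 + eta + 1\<close> and
  \<open>eta^4 = 2 eta^2 + 2 eta + 1\<close>.\<close>

definition "x * y = Trib
  (c0 x * c0 y + c1 y * c2 x + c2 y * (c1 x + c2 x))
  (c0 y * c1 x + c1 y * (c0 x + c2 x) + c2 y * (c1 x + 2 * c2 x))
  (c0 y * c2 x + c1 y * (c1 x + c2 x) + c2 y * (c0 x + c1 x + 2 * c2 x))"

instance
proof
  fix x y z :: trib
  show "x * y * z = x * (y * z)"
    by (simp add: times_trib_def) (intro conjI; algebra)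
qed (simp_all add: zero_trib_def one_trib_def plus_trib_def uminus_trib_def minus_trib_def
      times_trib_def algebra_simps trib.expand)

end

lemmas trib_arith = zero_trib_def one_trib_def plus_trib_def uminus_trib_def minus_trib_def
  times_trib_def

lemma of_nat_trib: "of_nat n = Trib (int n) 0 0"
  by (induction n) (simp_all add: trib_arith)

lemma of_int_trib: "of_int n = Trib n 0 0"
  by (cases n) (simp_all add: trib_arith of_nat_trib)

lemma numeral_trib: "numeral n = Trib (numeral n) 0 0"
  using of_int_trib[of "numeral n"] by simp

definition eta :: trib where "eta = Trib 0 1 0"

lemma trib_square:
  "(Trib a b c)\<^sup>2 = Trib (a\<^sup>2 + 2 * b * c + c\<^sup>2) (2 * (a * b + b * c + c\<^sup>2))
     (b\<^sup>2 + 2 * a * c + 2 * b * c + 2 * c\<^sup>2)"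
  by (simp add: power2_eq_square times_trib_def algebra_simps)

lemma eta_times: "eta * Trib a b c = Trib c (a + c) (b + c)"
  by (simp add: eta_def times_trib_def algebra_simps)

definition eta_inv :: trib where "eta_inv = Trib (-1) (-1) 1"

lemma eta_inv: "eta * eta_inv = 1"
  by (simp add: eta_def eta_inv_def trib_arith)

text \<open>
  \<open>cof x\<close> is the product of the two other conjugates of \<open>x\<close>.
\<close>

definition cof :: "trib \<Rightarrow> trib" where
  "cof x = Trib ((c0 x + c2 x) * (c0 x + c1 x + 2 * c2 x) - (c1 x + 2 * c2 x) * (c1 x + c2 x))
    ((c1 x + 2 * c2 x) * c2 x - c1 x * (c0 x + c1 x + 2 * c2 x))
    (c1 x * (c1 x + c2 x) - c2 x * (c0 x + c2 x))"

text \<open>The constant coordinate of \<open>x * cof x\<close>; the other two vanish by the choice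
  of \<open>cof\<close>.\<close>

definition nrm :: "trib \<Rightarrow> int" where
  "nrm x = c0 x * c0 (cof x) + c2 x * c1 (cof x) + (c1 x + c2 x) * c2 (cof x)"

lemma mult_cof: "x * cof x = of_int (nrm x)"
  by (cases x) (simp add: of_int_trib nrm_def cof_def times_trib_def algebra_simps)

definition ev :: "'a::comm_ring_1 \<Rightarrow> trib \<Rightarrow> 'a" where
  "ev r x = of_int (c0 x) + of_int (c1 x) * r + of_int (c2 x) * r\<^sup>2"

lemma ev_diff: "ev r (x - y) = ev r x - ev r y"
  and ev_of_int: "ev r (of_int n) = of_int n"
  and ev_one: "ev r 1 = 1"
  and ev_eta: "ev r eta = r"
  by (simp_all add: ev_def trib_arith of_int_trib eta_def algebra_simps)

lemma ev_mult:
  assumes "r ^ 3 = r\<^sup>2 + r + 1"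
  shows "ev r (x * y) = ev r x * ev r y"
proof -
  have r3: "r * (r * (r * z)) = r * (r * z) + r * z + z" for z
  proof -
    have "r * (r * (r * z)) = r ^ 3 * z"
      by (simp add: power3_eq_cube mult.assoc)
    then show ?thesis
      by (simp add: assms power2_eq_square algebra_simps)
  qed
  show ?thesis
    by (simp add: ev_def times_trib_def power2_eq_square algebra_simps r3)
qed

lemma ev_power:
  assumes "r ^ 3 = r\<^sup>2 + r + 1"
  shows "ev r (x ^ n) = ev r x ^ n"
  by (induction n) (simp_all add: ev_mult[OF assms] ev_one)

section \<open>The real and the complex embedding\<close>

definition eta_re :: real where
  "eta_re = (SOME x. 1839/1000 < x \<and> x < 46/25 \<and> x ^ 3 = x\<^sup>2 + x + 1)"

lemma eta_re: "1839/1000 < eta_re" "eta_re < 46/25" "eta_re ^ 3 = eta_re\<^sup>2 + eta_re + 1"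
proof -
  define h :: "real \<Rightarrow> real" where "h = (\<lambda>x. x ^ 3 - x\<^sup>2 - x - 1)"
  have "\<exists>x\<ge>1839/1000. x \<le> 46/25 \<and> h x = 0"
    by (rule IVT') (auto simp: h_def power3_eq_cube power2_eq_square intro!: continuous_intros)
  then obtain x where x: "1839/1000 \<le> x" "x \<le> 46/25" "h x = 0" by blast
  have "h (1839/1000) \<noteq> 0" "h (46/25) \<noteq> 0"
    by (simp_all add: h_def power3_eq_cube power2_eq_square)
  then have "x \<noteq> 1839/1000" "x \<noteq> 46/25"
    using x(3) by metis+
  then have "\<exists>x. 1839/1000 < x \<and> x < 46/25 \<and> x ^ 3 = x\<^sup>2 + (x::real) + 1"
    using x by (intro exI[of _ x]) (auto simp: h_def)
  from someI_ex[OF this]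
  show "1839/1000 < eta_re" "eta_re < 46/25" "eta_re ^ 3 = eta_re\<^sup>2 + eta_re + 1"
    unfolding eta_re_def by auto
qed

text \<open>By Vieta the nonreal roots have sum \<open>1 - eta_re\<close> and product
  \<open>1 / eta_re = eta_re^2 - eta_re - 1\<close>; the radicand is this product minus the squared
  real part.\<close>

definition eta_cx :: complex where
  "eta_cx = Complex ((1 - eta_re) / 2) (sqrt ((3 * eta_re\<^sup>2 - 2 * eta_re - 5) / 4))"

lemma Re_eta_cx: "Re eta_cx = (1 - eta_re) / 2"
  by (simp add: eta_cx_def)

lemma Im_eta_cx_sq: "(Im eta_cx)\<^sup>2 = (3 * eta_re\<^sup>2 - 2 * eta_re - 5) / 4"
  and Im_eta_cx_gt: "0.6 < Im eta_cx"
proof -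
  \<comment> \<open>Four times the radicand, factored so that both factors increase with
    \<open>eta_re\<close>.\<close>
  have "(3 * eta_re - 5) * (eta_re + 1) \<ge> (3 * 1.839 - 5) * (1.839 + 1)"
    using eta_re by (intro mult_mono) auto
  then have *: "3 * eta_re\<^sup>2 - 2 * eta_re - 5 > 4 * 0.6\<^sup>2"
    by (simp add: power2_eq_square algebra_simps)
  then have "(3 * eta_re\<^sup>2 - 2 * eta_re - 5) / 4 \<ge> 0"
    by (simp add: power2_eq_square)
  then show "(Im eta_cx)\<^sup>2 = (3 * eta_re\<^sup>2 - 2 * eta_re - 5) / 4"
    unfolding eta_cx_def complex.sel by (rule real_sqrt_pow2)
  show "0.6 < Im eta_cx"
    unfolding eta_cx_def complex.sel by (rule real_less_rsqrt) (use * in simp)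
qed

lemma eta_cx_quadratic: "eta_cx\<^sup>2 = of_real (1 - eta_re) * eta_cx - of_real (eta_re\<^sup>2 - eta_re - 1)"
proof (rule complex_eqI)
  show "Re (eta_cx\<^sup>2) = Re (of_real (1 - eta_re) * eta_cx - of_real (eta_re\<^sup>2 - eta_re - 1))"
    using Im_eta_cx_sq by (simp add: Re_eta_cx field_simps power2_eq_square)
  show "Im (eta_cx\<^sup>2) = Im (of_real (1 - eta_re) * eta_cx - of_real (eta_re\<^sup>2 - eta_re - 1))"
    by (simp add: Re_eta_cx power2_eq_square)
qed

lemma eta_cx: "eta_cx ^ 3 = eta_cx\<^sup>2 + eta_cx + 1"
proof -
  have "(of_real (eta_re ^ 3) :: complex) = of_real (eta_re\<^sup>2 + eta_re + 1)"
    by (simp only: eta_re(3))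
  then show ?thesis
    using eta_cx_quadratic by (simp only: of_real_add of_real_diff of_real_power of_real_1) algebra
qed

abbreviation "re \<equiv> ev eta_re"
abbreviation "cx \<equiv> ev eta_cx"

lemmas re_mult = ev_mult[OF eta_re(3)]
lemmas cx_mult = ev_mult[OF eta_cx]

lemma Re_cx: "Re (cx (Trib a b c)) = a + b * (1 - eta_re) / 2 + c * (3 - eta_re\<^sup>2) / 2"
  and Im_cx: "Im (cx (Trib a b c)) = Im eta_cx * (b + c * (1 - eta_re))"
  unfolding ev_def eta_cx_quadratic
  by (simp_all add: Re_eta_cx field_simps power2_eq_square)

lemma cmod_cx_sq: "(cmod (cx x))\<^sup>2 = re (cof x)"
proof (cases x)
  case (Trib a b c)
  have "(cmod (cx x))\<^sup>2 = (a + b * (1 - eta_re) / 2 + c * (3 - eta_re\<^sup>2) / 2)\<^sup>2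
      + (3 * eta_re\<^sup>2 - 2 * eta_re - 5) / 4 * (b + c * (1 - eta_re))\<^sup>2"
    by (simp add: cmod_power2 Trib Re_cx Im_cx power_mult_distrib Im_eta_cx_sq)
  \<comment> \<open>The correction is a multiple of the minimal polynomial at \<open>eta_re\<close>,
    hence zero.\<close>
  also have "\<dots> = re (cof x) + (eta_re ^ 3 - eta_re\<^sup>2 - eta_re - 1) * (c\<^sup>2 * (eta_re - 1) - b * c)"
    unfolding Trib by (simp add: ev_def cof_def field_simps power2_eq_square power3_eq_cube)
  also have "\<dots> = re (cof x)"
    by (simp add: eta_re(3))
  finally show ?thesis .
qed

lemma re_cmod_cx: "re x * (cmod (cx x))\<^sup>2 = nrm x"
proof -
  have "re (x * cof x) = nrm x"
    by (simp add: mult_cof ev_of_int)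
  then show ?thesis
    by (simp add: re_mult cmod_cx_sq)
qed

text \<open>Both embeddings are multiplicative, so no polynomial identity in six variables has to be
  expanded.\<close>

lemma nrm_mult: "nrm (x * y) = nrm x * nrm y"
proof -
  have "real_of_int (nrm (x * y)) = real_of_int (nrm x * nrm y)"
    by (simp flip: re_cmod_cx add: re_mult cx_mult norm_mult power_mult_distrib)
  then show ?thesis
    by linarith
qed

section \<open>Short vectors in lattices of rank three\<close>

lemma almost_minimal:
  fixes f :: "'a \<Rightarrow> real"
  assumes "S \<noteq> {}" and nonneg: "\<And>x. x \<in> S \<Longrightarrow> 0 \<le> f x" and "0 < e"
  obtains x where "x \<in> S" "\<And>y. y \<in> S \<Longrightarrow> f x \<le> f y + e"
proof -
  have bdd: "bdd_below (f ` S)"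
    by (rule bdd_belowI2[of _ 0]) (fact nonneg)
  obtain z where "z \<in> f ` S" "z < Inf (f ` S) + e"
    using cInf_lessD[of "f ` S" "Inf (f ` S) + e"] assms by auto
  then obtain x where x: "x \<in> S" "f x < Inf (f ` S) + e"
    by blast
  have "f x \<le> f y + e" if "y \<in> S" for y
    using cInf_lower[OF imageI[OF that] bdd] x(2) by simp
  with x(1) show ?thesis
    using that by blast
qed

definition gram2 :: "'a::real_inner \<Rightarrow> 'a \<Rightarrow> real" where
  "gram2 a b = (a \<bullet> a) * (b \<bullet> b) - (a \<bullet> b)\<^sup>2"

definition gram3 :: "'a::real_inner \<Rightarrow> 'a \<Rightarrow> 'a \<Rightarrow> real" where
  "gram3 a b c = (a \<bullet> a) * (b \<bullet> b) * (c \<bullet> c) + 2 * (a \<bullet> b) * (b \<bullet> c) * (a \<bullet> c)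
     - (a \<bullet> a) * (b \<bullet> c)\<^sup>2 - (b \<bullet> b) * (a \<bullet> c)\<^sup>2 - (c \<bullet> c) * (a \<bullet> b)\<^sup>2"

lemma gram2_nonneg: "0 \<le> gram2 a b"
  using Cauchy_Schwarz_ineq[of a b] by (simp add: gram2_def)

lemma gram3_swap: "gram3 b a c = gram3 a b c" "gram3 a c b = gram3 a b c"
  by (simp_all add: gram3_def inner_commute algebra_simps)

text \<open>Together with \<open>gram3_swap\<close>: these basis changes stay inside the set over
  which \<open>short_lattice_vector\<close> minimises.\<close>

lemma gram3_shift: "gram3 a (b - k *\<^sub>R a) c = gram3 a b c" "gram3 a b (c - k *\<^sub>R b) = gram3 a b c"
  by (simp_all add: gram3_def inner_commute inner_diff_left inner_diff_right power2_eq_square algebra_simps)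

text \<open>Sylvester's determinant identity for the Gram matrix. It lets the projection orthogonal
  to \<open>a\<close> be treated like a lattice of rank two.\<close>

lemma gram2_mult_gram2:
  "gram2 a b * gram2 a c = (a \<bullet> a) * gram3 a b c + ((a \<bullet> a) * (b \<bullet> c) - (a \<bullet> b) * (a \<bullet> c))\<^sup>2"
  by (simp add: gram2_def gram3_def power2_eq_square algebra_simps)

lemma abs_diff_round_le: "\<bar>x - of_int (round x)\<bar> \<le> 1 / 2" for x :: real
  using of_int_round_abs_le[of x] by (simp add: abs_minus_commute)

lemma round_remainder:
  fixes t d :: real
  assumes "0 < d"
  shows "(t - of_int (round (t / d)) * d)\<^sup>2 \<le> d\<^sup>2 / 4"
proof -
  have "t - of_int (round (t / d)) * d = (t / d - of_int (round (t / d))) * d"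
    using assms by (simp add: field_simps)
  then have "\<bar>t - of_int (round (t / d)) * d\<bar> \<le> 1 / 2 * d"
    using assms mult_right_mono[OF abs_diff_round_le, of d "t / d"] by (simp add: abs_mult)
  then have "(t - of_int (round (t / d)) * d)\<^sup>2 \<le> (1 / 2 * d)\<^sup>2"
    by (metis abs_ge_zero power2_abs power_mono)
  then show ?thesis
    by (simp add: power2_eq_square)
qed

text \<open>
  The basis is LLL-reduced up to the additive slack \<open>e\<close>, which makes it unnecessary to know that
  minima are attained; \<open>d\<close> is the Gram determinant of its first two vectors. For \<open>e = 0\<close> the two
  inequalities combine to Hermite's bound \<open>(a \<bullet> a)^3 \<le> (4/3)^3 D\<close>.
\<close>

lemma short_lattice_vector:
  fixes L :: "'a::real_inner set"
  assumes diff: "\<And>x y. x \<in> L \<Longrightarrow> y \<in> L \<Longrightarrow> x - y \<in> L"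
    and L: "u \<in> L" "v \<in> L" "w \<in> L" and D: "gram3 u v w = D" "0 < D" and e: "0 < e"
  obtains a d where "a \<in> L" "a \<noteq> 0"
    "3 / 4 * (a \<bullet> a)\<^sup>2 \<le> d + e * (a \<bullet> a)" "3 / 4 * d\<^sup>2 \<le> D * (a \<bullet> a) + e * d" "0 < d"
proof -
  have zero: "0 \<in> L"
    using diff[OF L(1) L(1)] by simp
  have minus: "- x \<in> L" if "x \<in> L" for x
    using diff[OF zero that] by simp
  have add: "x + y \<in> L" if "x \<in> L" "y \<in> L" for x y
    using diff[OF that(1) minus[OF that(2)]] by simp
  have nat_scale: "of_nat n *\<^sub>R x \<in> L" if "x \<in> L" for n x
    by (induction n) (simp_all add: zero scaleR_add_left add that)
  have int_scale: "of_int k *\<^sub>R x \<in> L" if "x \<in> L" for k x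
    using nat_scale[OF that] minus[OF nat_scale[OF that]] by (cases k rule: int_cases2) auto
  define S where "S = {(a, b, c). a \<in> L \<and> b \<in> L \<and> c \<in> L \<and> gram3 a b c = D}"
  have "(u, v, w) \<in> S"
    using L D by (simp add: S_def)
  then have "S \<noteq> {}" by blast
  then obtain s where s: "s \<in> S" "\<And>y. y \<in> S \<Longrightarrow> fst s \<bullet> fst s \<le> fst y \<bullet> fst y + e"
    by (rule almost_minimal[of S "\<lambda>s. fst s \<bullet> fst s" e]) (use e in auto)
  obtain a b0 c0' where s_eq: "s = (a, b0, c0')" by (cases s)
  \<comment> \<open>With \<open>a\<close> fixed, minimising \<open>gram2 a b\<close> minimises the
    component of \<open>b\<close> orthogonal to \<open>a\<close>.\<close>
  define S' where "S' = {(b, c). (a, b, c) \<in> S}"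
  have "S' \<noteq> {}"
    using s(1) by (auto simp: S'_def s_eq)
  then obtain s' where s': "s' \<in> S'" "\<And>y. y \<in> S' \<Longrightarrow> gram2 a (fst s') \<le> gram2 a (fst y) + e"
    by (rule almost_minimal[of S' "\<lambda>s. gram2 a (fst s)" e]) (use e gram2_nonneg in auto)
  obtain b c where s'_eq: "s' = (b, c)" by (cases s')
  have in_S: "(a, b, c) \<in> S"
    using s'(1) by (simp add: S'_def s'_eq)
  then have abc: "a \<in> L" "b \<in> L" "c \<in> L" "gram3 a b c = D"
    by (auto simp: S_def)
  have "a \<noteq> 0"
    using abc(4) D(2) by (auto simp: gram3_def)
  then have M: "0 < a \<bullet> a"
    by simp
  define d where "d = gram2 a b"
  have "d \<noteq> 0"
  proof
    assume "d = 0"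
    then have "(a \<bullet> a) * D + ((a \<bullet> a) * (b \<bullet> c) - (a \<bullet> b) * (a \<bullet> c))\<^sup>2 = 0"
      using gram2_mult_gram2[of a b c] by (simp add: d_def abc)
    moreover have "0 < (a \<bullet> a) * D" "0 \<le> ((a \<bullet> a) * (b \<bullet> c) - (a \<bullet> b) * (a \<bullet> c))\<^sup>2"
      using M D by simp_all
    ultimately show False by linarith
  qed
  then have d: "0 < d"
    using gram2_nonneg[of a b] by (simp add: d_def)
  define k where "k = round ((a \<bullet> b) / (a \<bullet> a))"
  define b' where "b' = b - of_int k *\<^sub>R a"
  \<comment> \<open>\<open>b'\<close> may serve as first basis vector, so near-minimality of
    \<open>a\<close> bounds its length from below.\<close>
  have "(b', a, c) \<in> S"
    using abc int_scale diff by (simp add: S_def b'_def gram3_swap gram3_shift)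
  then have "a \<bullet> a \<le> b' \<bullet> b' + e"
    using s(2) by (force simp: s_eq)
  then have "(a \<bullet> a) * (a \<bullet> a) \<le> (a \<bullet> a) * (b' \<bullet> b' + e)"
    using M by simp
  also have "\<dots> = (a \<bullet> a) * (b' \<bullet> b') + e * (a \<bullet> a)"
    by (simp add: algebra_simps)
  also have "(a \<bullet> a) * (b' \<bullet> b') = d + (a \<bullet> b - of_int k * (a \<bullet> a))\<^sup>2"
    by (simp add: b'_def d_def gram2_def inner_commute inner_diff_left inner_diff_right power2_eq_square algebra_simps)
  also have "(a \<bullet> b - of_int k * (a \<bullet> a))\<^sup>2 \<le> (a \<bullet> a)\<^sup>2 / 4"
    unfolding k_def by (rule round_remainder[OF M])
  finally have first: "3 / 4 * (a \<bullet> a)\<^sup>2 \<le> d + e * (a \<bullet> a)"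
    by (simp add: power2_eq_square)
  \<comment> \<open>\<open>t / d\<close> is the coefficient of \<open>c\<close> along
    \<open>b\<close> after both are projected orthogonally to \<open>a\<close>.\<close>
  define t where "t = (a \<bullet> a) * (b \<bullet> c) - (a \<bullet> b) * (a \<bullet> c)"
  define l where "l = round (t / d)"
  define c' where "c' = c - of_int l *\<^sub>R b"
  have "(a, c', b) \<in> S"
    using abc int_scale diff by (simp add: S_def c'_def gram3_swap gram3_shift)
  then have "d \<le> gram2 a c' + e"
    using s'(2)[of "(c', b)"] by (simp add: s'_eq S'_def d_def)
  then have "d * d \<le> d * (gram2 a c' + e)"
    using d by simp
  also have "\<dots> = gram2 a b * gram2 a c' + e * d"
    by (simp add: d_def algebra_simps)
  also have "gram2 a b * gram2 a c' = (a \<bullet> a) * D + (t - of_int l * d)\<^sup>2"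
  proof -
    have "(a \<bullet> a) * (b \<bullet> c') - (a \<bullet> b) * (a \<bullet> c') = t - of_int l * d"
      by (simp add: c'_def t_def d_def gram2_def inner_commute inner_diff_left inner_diff_right
          power2_eq_square algebra_simps)
    then show ?thesis
      unfolding gram2_mult_gram2 by (simp add: c'_def gram3_shift abc)
  qed
  also have "(t - of_int l * d)\<^sup>2 \<le> d\<^sup>2 / 4"
    unfolding l_def by (rule round_remainder[OF d])
  finally have "3 / 4 * d\<^sup>2 \<le> D * (a \<bullet> a) + e * d"
    by (simp add: power2_eq_square mult.commute[of D])
  with \<open>a \<noteq> 0\<close> abc(1) first d show ?thesis
    using that by blast
qed

section \<open>Elements of square norm\<close>

text \<open>The prime 2 is totally ramified: \<open>1 + eta\<close> has norm 2 and a residue field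
  of two elements in which \<open>eta\<close> is 1, so the class of \<open>x\<close> is the parity
  of its coordinate sum.\<close>

lemma even_nrm_imp_dvd:
  assumes "even (nrm x)"
  obtains y where "x = (1 + eta) * y"
proof -
  obtain a b c where x: "x = Trib a b c" by (cases x)
  have "even (a + b + c)"
    using assms by (auto simp: x nrm_def cof_def)
  then obtain k where "a + b + c = 2 * k" by (elim evenE)
  then have "a = 2 * k - b - c" by simp
  then have "x = (1 + eta) * Trib (k - c) (2 * b + c - 2 * k) (k - b)"
    by (simp add: x times_trib_def plus_trib_def one_trib_def eta_def)
  then show ?thesis
    using that by blast
qed

lemma nrm_one_plus_eta: "nrm (1 + eta) = 2"
  by (simp add: nrm_def cof_def trib_arith eta_def)

lemma one_plus_eta_cubed: "(1 + eta) ^ 3 = 2 * eta ^ 4"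
  by (simp add: power3_eq_cube power4_eq_xxxx eta_def trib_arith numeral_trib)

lemma eight_dvd_nrm_imp:
  assumes "8 dvd nrm x"
  shows "2 dvd x"
proof -
  obtain k where k: "nrm x = 8 * k"
    using assms by (elim dvdE)
  then obtain y where y: "x = (1 + eta) * y"
    using even_nrm_imp_dvd[of x] by auto
  with k have "nrm y = 4 * k"
    by (simp add: nrm_mult nrm_one_plus_eta)
  then obtain z where z: "y = (1 + eta) * z"
    using even_nrm_imp_dvd[of y] by auto
  with \<open>nrm y = 4 * k\<close> have "nrm z = 2 * k"
    by (simp add: nrm_mult nrm_one_plus_eta)
  then obtain w where "z = (1 + eta) * w"
    using even_nrm_imp_dvd[of z] by auto
  then have "x = (1 + eta) ^ 3 * w"
    by (simp add: y z power3_eq_cube mult.assoc)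
  then show ?thesis
    by (simp add: one_plus_eta_cubed mult.assoc)
qed

text \<open>Infinite descent at 2 replaces irreducibility of the cubic: norm 0 is divisible by 8,
  hence \<open>x\<close> by 2, and the half has norm 0 again.\<close>

lemma nrm_eq_0: "nrm x = 0 \<longleftrightarrow> x = 0"
proof
  assume "nrm x = 0"
  then show "x = 0"
  proof (induction "nat (\<bar>c0 x\<bar> + \<bar>c1 x\<bar> + \<bar>c2 x\<bar>)" arbitrary: x rule: less_induct)
    case less
    then obtain y where y: "x = 2 * y"
      using eight_dvd_nrm_imp[of x] by (auto elim: dvdE)
    have "nrm 2 = 8"
      by (simp add: nrm_def cof_def numeral_trib)
    with less.prems have "nrm y = 0"
      by (simp add: y nrm_mult)
    obtain a b c where abc: "y = Trib a b c" by (cases y)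
    show ?case
    proof (rule ccontr)
      assume "x \<noteq> 0"
      then have "nat (\<bar>c0 y\<bar> + \<bar>c1 y\<bar> + \<bar>c2 y\<bar>) < nat (\<bar>c0 x\<bar> + \<bar>c1 x\<bar> + \<bar>c2 x\<bar>)"
        by (simp add: y abc times_trib_def numeral_trib zero_trib_def) linarith
      then have "y = 0"
        using less.hyps \<open>nrm y = 0\<close> by blast
      with \<open>x \<noteq> 0\<close> y show False by simp
    qed
  qed
qed (simp add: nrm_def cof_def zero_trib_def)

section \<open>The weighted Minkowski embedding and its covolume\<close>

definition embed :: "real \<Rightarrow> real \<Rightarrow> trib \<Rightarrow> real \<times> complex" where
  "embed u v x = (u * re x, v *\<^sub>R cx x)"

lemma inner_embed: "embed u v x \<bullet> embed u v x = u\<^sup>2 * (re x)\<^sup>2 + v\<^sup>2 * (cmod (cx x))\<^sup>2"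
  by (simp only: embed_def inner_Pair inner_complex_def)
    (simp add: cmod_power2, simp add: power2_eq_square algebra_simps)

text \<open>The Gram determinant is the square of the determinant of the real coordinates.\<close>

lemma gram3_real_complex:
  fixes p q r :: real and z y x :: complex
  shows "gram3 (p, z) (q, y) (r, x) = (p * (Re y * Im x - Im y * Re x) - q * (Re z * Im x - Im z * Re x)
    + r * (Re z * Im y - Im z * Re y))\<^sup>2"
  by (simp add: gram3_def inner_Pair inner_complex_def power2_eq_square algebra_simps)

text \<open>The factor \<open>3 t^2 - 2 t - 1\<close> is the derivative of the minimal polynomial;
  up to the factor -4 the left side is the discriminant -44.\<close>

lemma eta_disc: "(Im eta_cx)\<^sup>2 * (3 * eta_re\<^sup>2 - 2 * eta_re - 1)\<^sup>2 = 11"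
proof -
  have "(3 * eta_re\<^sup>2 - 2 * eta_re - 5) * (3 * eta_re\<^sup>2 - 2 * eta_re - 1)\<^sup>2 = 44"
    using eta_re(3) by algebra
  then show ?thesis
    by (simp add: Im_eta_cx_sq)
qed

lemma gram3_embed:
  "gram3 (embed u v (of_int m)) (embed u v (eta - of_int s)) (embed u v (eta\<^sup>2 - of_int (s\<^sup>2)))
    = 11 * (of_int m * u * v\<^sup>2)\<^sup>2"
proof -
  \<comment> \<open>The coordinate determinant is \<open>m\<close> times a Vandermonde determinant
    in the three roots, since the shifts by \<open>s\<close> and \<open>s^2\<close> drop
    out.\<close>
  define X Y where "X = Re eta_cx" and "Y = Im eta_cx"
  have "gram3 (embed u v (of_int m)) (embed u v (eta - of_int s)) (embed u v (eta\<^sup>2 - of_int (s\<^sup>2)))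
    = (of_int m * u * v\<^sup>2 * (Y * ((X - eta_re)\<^sup>2 + Y\<^sup>2)))\<^sup>2"
    unfolding embed_def gram3_real_complex ev_diff ev_of_int ev_eta ev_power[OF eta_re(3)]
      ev_power[OF eta_cx] X_def Y_def
    by (rule arg_cong[of _ _ "\<lambda>x. x\<^sup>2"]) (simp add: power2_eq_square algebra_simps)
  also have "(X - eta_re)\<^sup>2 + Y\<^sup>2 = 3 * eta_re\<^sup>2 - 2 * eta_re - 1"
    unfolding X_def Y_def Re_eta_cx Im_eta_cx_sq by (simp add: power2_eq_square field_simps)
  finally show ?thesis
    using eta_disc by (simp add: power_mult_distrib Y_def)
qed

lemma AM_GM_cubed:
  fixes x y T :: real
  assumes "0 \<le> x" "0 \<le> y" "x + 2 * y \<le> T"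
  shows "27 * (x * y\<^sup>2) \<le> T ^ 3"
proof -
  have "27 * (x * y\<^sup>2) \<le> (x + 2 * y) ^ 3"
  proof -
    have "(x + 2 * y) ^ 3 - 27 * (x * y\<^sup>2) = (x - y)\<^sup>2 * (x + 8 * y)"
      by (simp add: power2_eq_square power3_eq_cube algebra_simps)
    moreover have "0 \<le> (x - y)\<^sup>2 * (x + 8 * y)"
      using assms by simp
    ultimately show ?thesis by linarith
  qed
  also have "\<dots> \<le> T ^ 3"
    using assms by (intro power_mono) auto
  finally show ?thesis .
qed

text \<open>For \<open>n\<close> the norm of \<open>b^2 / al\<close>: it is a square because
  \<open>al\<close> has square norm, and 1 is the only positive square below 4.\<close>

lemma square_factor_less_4:
  fixes n m k :: int
  assumes "n * m\<^sup>2 = k\<^sup>2" "m \<noteq> 0" "n < 4" "0 < n"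
  shows "n = 1"
proof -
  have "m\<^sup>2 dvd k\<^sup>2"
    by (metis assms(1) dvd_triv_right)
  then obtain l where "k = m * l"
    by (auto elim: dvdE)
  then have "n = l\<^sup>2"
    using assms by (simp add: power_mult_distrib)
  then have "\<bar>l\<bar> < 2"
    using assms(3) by (intro power2_less_imp_less[of _ 2]) simp_all
  then have "l = -1 \<or> l = 0 \<or> l = 1" by linarith
  then show ?thesis
    using \<open>n = l\<^sup>2\<close> assms(4) by auto
qed

text \<open>
  For \<open>b = m x + al y\<close> the square \<open>b^2\<close> is divisible by \<open>al\<close>, because \<open>m^2 = al * cof al\<close>. The hypothesis
  \<open>root\<close> says that the ideal \<open>(m, al)\<close> has index at most \<open>m\<close>.
\<close>

lemma norm_one_quotient:
  assumes norm: "nrm al = m\<^sup>2" and m: "m \<noteq> 0"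
    and root: "eta - of_int s = of_int m * p + al * q"
  obtains b g where "al * g = b\<^sup>2" "nrm g = 1"
proof -
  define I where "I = {of_int m * x + al * y | x y. True}"
  have I_diff: "x - y \<in> I" if "x \<in> I" "y \<in> I" for x y
  proof -
    obtain x1 x2 y1 y2 where "x = of_int m * x1 + al * x2" "y = of_int m * y1 + al * y2"
      using \<open>x \<in> I\<close> \<open>y \<in> I\<close> by (auto simp: I_def)
    then have "x - y = of_int m * (x1 - y1) + al * (x2 - y2)"
      by (simp add: algebra_simps)
    then show ?thesis
      unfolding I_def by blast
  qed
  have I_m: "of_int m \<in> I"
    unfolding I_def by (rule CollectI, rule exI[of _ 1], rule exI[of _ 0]) simp
  have I_1: "eta - of_int s \<in> I"
    unfolding I_def using root by blast
  have "eta\<^sup>2 - of_int (s\<^sup>2) = (of_int m * p + al * q) * (eta + of_int s)"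
    unfolding root[symmetric] by (simp add: power2_eq_square algebra_simps)
  also have "\<dots> = of_int m * (p * (eta + of_int s)) + al * (q * (eta + of_int s))"
    by (simp add: algebra_simps)
  finally have I_2: "eta\<^sup>2 - of_int (s\<^sup>2) \<in> I"
    unfolding I_def by blast
  have norm_pos: "0 < re al * (cmod (cx al))\<^sup>2"
    using m by (simp add: re_cmod_cx norm)
  then have pos: "0 < re al" "0 < cmod (cx al)"
    by (auto simp: zero_less_mult_iff)
  \<comment> \<open>For \<open>g = b^2 / al\<close> these weights give \<open>embed u v b\<close>
    the squared length \<open>re g + 2 |cx g|\<close>, the sum of the absolute values of the three
    conjugates of \<open>g\<close>, to which AM-GM applies.\<close>
  define u v where "u = 1 / sqrt (re al)" and "v = sqrt (2 / cmod (cx al))"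
  have u2: "u\<^sup>2 = 1 / re al" and v2: "v\<^sup>2 = 2 / cmod (cx al)"
    using pos by (simp_all add: u_def v_def power_divide)
  \<comment> \<open>As \<open>re al * |cx al|^2 = m^2\<close>, the twist cancels \<open>m\<close>
    and leaves \<open>11 * 4\<close>.\<close>
  have "11 * (of_int m * u * v\<^sup>2)\<^sup>2 = 11 * (m\<^sup>2 * u\<^sup>2 * (v\<^sup>2)\<^sup>2)"
    by (simp add: power_mult_distrib)
  also have "\<dots> = 44 * m\<^sup>2 / (re al * (cmod (cx al))\<^sup>2)"
    by (simp add: u2 v2 power_divide)
  also have "\<dots> = 44"
    using m by (simp add: re_cmod_cx norm)
  finally have gram: "gram3 (embed u v (of_int m)) (embed u v (eta - of_int s))
      (embed u v (eta\<^sup>2 - of_int (s\<^sup>2))) = 44"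
    by (subst gram3_embed)
  have emb_diff: "x - y \<in> embed u v ` I" if xy: "x \<in> embed u v ` I" "y \<in> embed u v ` I" for x y
  proof -
    obtain x' y' where "x' \<in> I" "y' \<in> I" "x = embed u v x'" "y = embed u v y'"
      using xy by blast
    moreover have "embed u v x' - embed u v y' = embed u v (x' - y')"
      by (simp add: embed_def ev_diff algebra_simps scaleR_diff_right)
    ultimately show ?thesis
      using I_diff by simp
  qed
  obtain a d where a: "a \<in> embed u v ` I" "a \<noteq> 0"
    and red: "3 / 4 * (a \<bullet> a)\<^sup>2 \<le> d + 0.01 * (a \<bullet> a)" "3 / 4 * d\<^sup>2 \<le> 44 * (a \<bullet> a) + 0.01 * d" "0 < d"
    by (rule short_lattice_vector[OF emb_diff imageI[OF I_m] imageI[OF I_1] imageI[OF I_2] gram, of "0.01"])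
      (assumption, assumption, simp, simp, rule that, assumption+)
  obtain b where b: "b \<in> I" "a = embed u v b"
    using a(1) by blast
  have "b \<noteq> 0"
    using a(2) b(2) by (auto simp: embed_def ev_def zero_trib_def zero_prod_def)
  obtain x y where b_eq: "b = of_int m * x + al * y"
    using b(1) by (auto simp: I_def)
  define g where "g = cof al * x\<^sup>2 + 2 * of_int m * x * y + al * y\<^sup>2"
  have "of_int m ^ 2 = al * cof al"
    by (simp add: mult_cof norm)
  then have al_g: "al * g = b\<^sup>2"
    by (simp add: g_def b_eq power2_eq_square algebra_simps)
  define T where "T = a \<bullet> a"
  have re_g: "re g = (re b)\<^sup>2 / re al"
    using arg_cong[OF al_g, of re] pos by (simp add: re_mult ev_power[OF eta_re(3)] field_simps)
  have cx_g: "cmod (cx g) = (cmod (cx b))\<^sup>2 / cmod (cx al)"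
    using arg_cong[OF al_g, of "\<lambda>x. cmod (cx x)"] pos
    by (simp add: cx_mult ev_power[OF eta_cx] norm_mult norm_power field_simps)
  have T_eq: "T = re g + 2 * cmod (cx g)"
    by (simp add: T_def b(2) inner_embed u2 v2 re_g cx_g)
  \<comment> \<open>Hermite's bound is about 4.71, and AM-GM turns any bound below 4.76 into \<open>nrm g < 4\<close>.\<close>
  have "T \<le> 4.75"
  proof (rule ccontr)
    assume "\<not> T \<le> 4.75"
    then have T: "T > 4.75" by simp
    \<comment> \<open>3.55 lies just below \<open>3/4 * 4.75 - 0.01\<close>, and 2.66 just below
      \<open>3/4 * 3.55\<close> with room for the slack. They give
      \<open>d >= 3.55 * 4.75 > 16.8\<close> against \<open>d <= 44 / 2.66 < 16.6\<close>.\<close>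
    have "T * 3.55 \<le> T * (3 / 4 * T - 0.01)"
      using T by (intro mult_left_mono) auto
    also have "\<dots> \<le> d"
      using red(1) by (simp add: T_def power2_eq_square algebra_simps)
    finally have d1: "T * 3.55 \<le> d" .
    have "d * (2.66 * T) \<le> d * (3 / 4 * d - 0.01)"
      using d1 T red(3) by (intro mult_left_mono) auto
    also have "\<dots> \<le> 44 * T"
      using red(2) by (simp add: T_def power2_eq_square algebra_simps)
    finally have "T * (d * 2.66) \<le> T * 44"
      by (simp add: mult_ac)
    then have "d * 2.66 \<le> 44"
      using T by simp
    then show False
      using d1 T by simp
  qed
  have "0 \<le> re g"
    using re_g pos by simp
  then have "27 * (re g * (cmod (cx g))\<^sup>2) \<le> 4.75 ^ 3"
    using AM_GM_cubed[of "re g" "cmod (cx g)" "4.75"] T_eq \<open>T \<le> 4.75\<close> by simp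
  then have "real_of_int (nrm g) < 4"
    unfolding re_cmod_cx by (simp add: power3_eq_cube)
  then have "nrm g < 4" by simp
  have sq: "nrm g * m\<^sup>2 = (nrm b)\<^sup>2"
    using arg_cong[OF al_g, of nrm] by (simp add: nrm_mult norm power2_eq_square mult.commute)
  moreover have "nrm b \<noteq> 0"
    using \<open>b \<noteq> 0\<close> nrm_eq_0 by blast
  ultimately have "0 < nrm g * m\<^sup>2"
    by simp
  then have "0 < nrm g"
    by (simp add: zero_less_mult_iff)
  then have "nrm g = 1"
    using square_factor_less_4[OF sq m \<open>nrm g < 4\<close>] by simp
  with al_g show ?thesis
    using that by blast
qed

text \<open>The interval is a fundamental domain for multiplication by \<open>eta\<close>. Norm 1
  then bounds the complex embedding by 1, so few coordinates are possible; this is why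
  \<open>eta\<close> generates the units of norm 1.\<close>

lemma unit_normalized:
  assumes norm: "nrm x = 1" and bounds: "1 \<le> re x" "re x < eta_re"
  shows "x = 1"
proof -
  obtain a b c where x: "x = Trib a b c" by (cases x)
  define h :: real where "h = eta_re"
  \<comment> \<open>\<open>A\<close> equals \<open>Im (cx x) / Im eta_cx\<close>; the bound 1.667
    below is \<open>1 / 0.6\<close> rounded up.\<close>
  define A where "A = b + c * (1 - h)"
  have h: "1839/1000 < h" "h < 184/100"
    using eta_re by (simp_all add: h_def)
  have "1 * (cmod (cx x))\<^sup>2 \<le> re x * (cmod (cx x))\<^sup>2"
    using bounds by (intro mult_right_mono) auto
  then have "(cmod (cx x))\<^sup>2 \<le> 1\<^sup>2"
    by (simp add: re_cmod_cx norm)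
  then have cmod: "cmod (cx x) \<le> 1"
    by (rule power2_le_imp_le) simp
  have re: "re x = a + b * h + c * h\<^sup>2"
    by (simp add: x ev_def h_def)
  have re_bounds: "1 \<le> a + b * h + c * h\<^sup>2" "a + b * h + c * h\<^sup>2 < h"
    using bounds unfolding re by (simp_all add: h_def)
  have "\<bar>Im (cx x)\<bar> \<le> 1"
    using cmod abs_Im_le_cmod order_trans by blast
  then have "Im eta_cx * \<bar>A\<bar> \<le> 1"
    using Im_eta_cx_gt by (simp add: x Im_cx A_def h_def abs_mult)
  moreover have "6/10 * \<bar>A\<bar> \<le> Im eta_cx * \<bar>A\<bar>"
    using Im_eta_cx_gt by (intro mult_right_mono) auto
  ultimately have A: "\<bar>A\<bar> \<le> 1667/1000" by simp
  have "\<bar>Re (cx x)\<bar> \<le> 1"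
    using cmod abs_Re_le_cmod order_trans by blast
  \<comment> \<open>The difference of the two embeddings eliminates \<open>a\<close>; it lies
    between \<open>1 - 1\<close> and \<open>1.84 + 1\<close>.\<close>
  moreover have "b * (3 * h - 1) / 2 + c * (3 * h\<^sup>2 - 3) / 2 = re x - Re (cx x)"
    unfolding re unfolding x Re_cx h_def by (simp add: field_simps)
  ultimately have diff: "0 \<le> b * (3 * h - 1) / 2 + c * (3 * h\<^sup>2 - 3) / 2"
      "b * (3 * h - 1) / 2 + c * (3 * h\<^sup>2 - 3) / 2 < 284/100"
    using bounds h unfolding h_def by linarith+
  \<comment> \<open>Here 2.26 is \<open>(3 * 1.84 - 1) / 2\<close>. The term in \<open>A\<close> is
    at most 3.77, so the term in \<open>c\<close> lies in [-3.78, 6.62], and its coefficient is at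
    least 5.46.\<close>
  have "b * (3 * h - 1) / 2 + c * (3 * h\<^sup>2 - 3) / 2 = A * ((3 * h - 1) / 2) + c * ((h - 1) * (3 * h + 1))"
    by (simp add: A_def field_simps power2_eq_square)
  moreover have "\<bar>A\<bar> * ((3 * h - 1) / 2) \<le> (1667/1000) * (226/100)"
    using A h by (intro mult_mono) auto
  then have "\<bar>A * ((3 * h - 1) / 2)\<bar> \<le> (1667/1000) * (226/100)"
    using h by (simp add: abs_mult)
  ultimately have c_bounds: "-378/100 \<le> c * ((h - 1) * (3 * h + 1))" "c * ((h - 1) * (3 * h + 1)) \<le> 662/100"
    using diff by linarith+
  have coeff: "546/100 \<le> (h - 1) * (3 * h + 1)"
    using mult_mono[of "839/1000" "h - 1" "6517/1000" "3 * h + 1"] h by simp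
  have "c = 0 \<or> c = 1"
  proof (rule ccontr)
    assume "\<not> ?thesis"
    then consider "c \<le> -1" | "2 \<le> c" by linarith
    then show False
    proof cases
      case 1
      then have "real_of_int c * ((h - 1) * (3 * h + 1)) \<le> -1 * ((h - 1) * (3 * h + 1))"
        using coeff by (intro mult_right_mono) linarith+
      then show False using c_bounds coeff by linarith
    next
      case 2
      then have "2 * ((h - 1) * (3 * h + 1)) \<le> real_of_int c * ((h - 1) * (3 * h + 1))"
        using coeff by (intro mult_right_mono) linarith+
      then show False using c_bounds coeff by linarith
    qed
  qed
  then show ?thesis
  proof
    assume c: "c = 1"
    then have "\<bar>b + (1 - h)\<bar> \<le> 1667/1000"
      using A by (simp add: A_def)
    then have "-1 < real_of_int b"
      using h by linarith
    then have "0 \<le> b" by linarith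
    then have "0 \<le> b * (3 * h - 1) / 2"
      using h by simp
    moreover have "338/100 \<le> h * h"
      using mult_mono[of "1839/1000" h "1839/1000" h] h by simp
    moreover have "b * (3 * h - 1) / 2 + (3 * (h * h) - 3) / 2 < 284/100"
      using diff(2) by (simp only: c power2_eq_square of_int_1 mult_1)
    moreover have False if "0 \<le> P" "338/100 \<le> Q" "P + (3 * Q - 3) / 2 < 284/100" for P Q :: real
      using that by (simp add: field_simps)
    ultimately have False by blast
    then show ?thesis ..
  next
    assume c: "c = 0"
    have "0 \<le> b"
    proof (rule ccontr)
      assume "\<not> 0 \<le> b"
      then have "b * (3 * h - 1) < 0"
        using h by (intro mult_neg_pos) auto
      then show False using diff(1) c by simp
    qed
    moreover have "b < 2"
    proof (rule ccontr)
      assume "\<not> b < 2"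
      then have "2 * (3 * h - 1) \<le> real_of_int b * (3 * h - 1)"
        using h by (intro mult_right_mono) auto
      then show False using diff(2) c h by simp
    qed
    ultimately consider "b = 0" | "b = 1" by linarith
    then show ?thesis
    proof cases
      case 1
      then have "1 \<le> real_of_int a" "real_of_int a < 2"
        using re_bounds h c by simp_all
      then have "a = 1" by linarith
      then show ?thesis by (simp add: x c 1 one_trib_def)
    next
      case 2
      then have "-1 < real_of_int a" "real_of_int a < 0"
        using re_bounds h c by simp_all
      then have "-1 < a" "a < 0" by linarith+
      then show ?thesis by simp
    qed
  qed
qed

lemma eta_re_inv: "re eta_inv = inverse eta_re"
proof -
  have "re (eta * eta_inv) = 1"
    by (simp add: eta_inv ev_one)
  then show ?thesis
    by (simp add: re_mult ev_eta inverse_unique)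
qed

lemma nrm_eta: "nrm eta = 1" and nrm_eta_inv: "nrm eta_inv = 1"
  by (simp_all add: nrm_def cof_def eta_def eta_inv_def)

lemma nrm_power: "nrm (x ^ n) = nrm x ^ n"
  by (induction n) (simp_all add: nrm_mult, simp add: nrm_def cof_def one_trib_def)

lemma norm_one_unit:
  assumes "nrm x = 1"
  obtains k where "x = eta ^ k" | k where "x = eta_inv ^ k"
proof -
  have pos: "0 < re x"
    using re_cmod_cx[of x] assms by (metis of_int_1 zero_less_mult_iff zero_less_one not_less zero_le_power2)
  define k where "k = \<lfloor>log eta_re (re x)\<rfloor>"
  have "eta_re powr of_int k \<le> eta_re powr (log eta_re (re x))"
    using eta_re by (intro powr_mono) (auto simp: k_def)
  then have lower: "eta_re powr of_int k \<le> re x"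
    using eta_re pos by simp
  have "eta_re powr (log eta_re (re x)) < eta_re powr (of_int k + 1)"
    using eta_re by (intro powr_less_mono) (auto simp: k_def)
  then have upper: "re x < eta_re powr of_int k * eta_re"
    using eta_re pos by (simp add: powr_add)
  show ?thesis
  proof (cases k rule: int_cases2)
    case (nonneg n)
    then have pow: "eta_re powr of_int k = eta_re ^ n"
      using eta_re by (simp add: powr_realpow)
    have inv: "eta ^ n * eta_inv ^ n = 1"
      by (simp add: eta_inv flip: power_mult_distrib)
    have "x * eta_inv ^ n = 1"
      by (rule unit_normalized)
        (use lower upper eta_re in \<open>simp_all add: pow nrm_mult nrm_power nrm_eta_inv assms re_mult
          ev_power[OF eta_re(3)] eta_re_inv field_simps power_inverse\<close>)
    then have "x = eta ^ n"
      using inv by (metis mult.commute mult.left_commute mult.right_neutral)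
    then show ?thesis using that by blast
  next
    case (nonpos n)
    then have pow: "eta_re powr of_int k = inverse eta_re ^ n"
      using eta_re by (simp add: powr_minus powr_realpow power_inverse)
    have inv: "eta ^ n * eta_inv ^ n = 1"
      by (simp add: eta_inv flip: power_mult_distrib)
    have "x * eta ^ n = 1"
      by (rule unit_normalized)
        (use lower upper eta_re in \<open>simp_all add: pow nrm_mult nrm_power nrm_eta assms re_mult
          ev_power[OF eta_re(3)] ev_eta field_simps power_inverse\<close>)
    then have "x = eta_inv ^ n"
      using inv by (metis mult.commute mult.left_commute mult.right_neutral)
    then show ?thesis using that by blast
  qed
qed

text \<open>\<open>al\<close> is \<open>b^2 / g\<close> with \<open>g\<close> a power of
  \<open>eta\<close>, so only the parity of the exponent matters; the unit -1 has norm -1 and does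
  not occur.\<close>

lemma norm_one_inverse_square_class:
  assumes "nrm g = 1" "al * g = b\<^sup>2"
  obtains d where "al = d\<^sup>2" | d where "al = eta * d\<^sup>2"
proof -
  have *: "\<exists>d. al = d\<^sup>2 \<or> al = eta * d\<^sup>2"
    if uv: "u * v = 1" "u = y \<or> v = y" "y = eta" and g: "g = u ^ k" for u v y k
  proof -
    have inv: "u ^ k * v ^ k = 1"
      by (simp add: uv(1) flip: power_mult_distrib)
    have "al = al * g * v ^ k"
      using inv by (simp add: g mult.assoc)
    then have al: "al = b\<^sup>2 * v ^ k"
      by (simp add: assms(2))
    show ?thesis
    proof (cases "even k")
      case True
      then obtain j where "k = 2 * j" by (elim evenE)
      then have "al = (b * v ^ j)\<^sup>2"
        using al by (simp add: power_mult_distrib power_even_eq)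
      then show ?thesis by blast
    next
      case False
      then obtain j where k: "k = 2 * j + 1" by (elim oddE)
      \<comment> \<open>As \<open>eta_inv = eta * eta_inv^2\<close>, odd powers of either unit lie
        in the class of \<open>eta\<close>.\<close>
      have v: "v = eta \<or> v = eta * v\<^sup>2"
        using uv by (auto simp: power2_eq_square simp flip: mult.assoc)
      have "al = v * (b * v ^ j)\<^sup>2"
        using al by (simp add: k power_mult_distrib mult_ac flip: power_mult)
      then have "al = eta * (b * v ^ j)\<^sup>2 \<or> al = eta * (v * (b * v ^ j))\<^sup>2"
        using v by (metis power_mult_distrib mult.assoc)
      then show ?thesis by blast
    qed
  qed
  from norm_one_unit[OF assms(1)] show ?thesis
  proof cases
    case (1 k)
    then show ?thesis
      using *[of eta eta_inv eta k] that eta_inv by blast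
  next
    case (2 k)
    then show ?thesis
      using *[of eta_inv eta eta k] that eta_inv by (metis mult.commute)
  qed
qed

section \<open>Integer preliminaries and the square classes used in the descents\<close>

lemma coprime_mult_eq_square:
  fixes a b r :: int
  assumes "coprime a b" "0 < a" "0 < b" "a * b = r\<^sup>2"
  obtains u v where "0 < u" "0 < v" "a = u\<^sup>2" "b = v\<^sup>2"
proof -
  have "int (nat a * nat b) = int (nat \<bar>r\<bar> ^ 2)"
    using assms by simp
  then have "is_nth_power 2 (nat a * nat b)"
    unfolding is_nth_power_def by (metis of_nat_eq_iff)
  moreover have "coprime (nat a) (nat b)"
    using assms by (simp add: coprime_int_iff[symmetric])
  ultimately have "is_nth_power 2 (nat a)" "is_nth_power 2 (nat b)"
    using is_nth_power_mult_coprime_nat_iff[of "nat a" "nat b" 2] by auto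
  then obtain u v where "nat a = u\<^sup>2" "nat b = v\<^sup>2"
    by (auto elim!: is_nth_powerE)
  then have "a = (int u)\<^sup>2" "b = (int v)\<^sup>2"
    using assms by (metis int_nat_eq less_imp_le of_nat_power)+
  moreover have "0 < int u" "0 < int v"
    using calculation assms by (metis of_nat_0_less_iff gr0I of_nat_0 less_irrefl zero_power2)+
  ultimately show ?thesis
    using that by blast
qed

lemma reduced_fraction:
  fixes a b :: int
  assumes "b \<noteq> 0"
  obtains p q t where "a = p * t" "b = q * t" "0 < q" "coprime p q" "t \<noteq> 0"
proof -
  define g where "g = gcd a b"
  have "g \<noteq> 0"
    using assms by (simp add: g_def)
  then obtain a' b' where *: "a = a' * g" "b = b' * g" "coprime a' b'"
    using gcd_coprime_exists[of a b] unfolding g_def[symmetric] by blast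
  show thesis
  proof (cases "0 < b'")
    case True
    then show ?thesis
      using that[of a' g b'] * \<open>g \<noteq> 0\<close> by simp
  next
    case False
    then have "0 < - b'"
      using *(2) assms by (cases "b' = 0") auto
    then show ?thesis
      using that[of "- a'" "- g" "- b'"] * \<open>g \<noteq> 0\<close> by simp
  qed
qed

lemma square_class:
  assumes "nrm al = m\<^sup>2" "m \<noteq> 0" "eta - of_int s = of_int m * p + al * q"
  obtains d where "al = d\<^sup>2" | d where "al = eta * d\<^sup>2"
  using norm_one_quotient[OF assms] norm_one_inverse_square_class by metis

text \<open>\<open>P + Q eta\<close> lies in the ideal \<open>(m, al)\<close> and \<open>Q\<close>
  is invertible modulo \<open>m\<close>, so \<open>eta\<close> is congruent to an integer. The
  factor \<open>y\<close> allows \<open>al\<close> to be a proper divisor of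
  \<open>P + Q eta\<close>.\<close>

lemma int_trib_square_class_linear:
  assumes "nrm al = m\<^sup>2" "m \<noteq> 0" "y * al = Trib P Q 0" "coprime Q m"
  obtains d where "al = d\<^sup>2" | d where "al = eta * d\<^sup>2"
proof -
  obtain u v where uv: "u * Q + v * m = 1"
    using bezout_int[of Q m] assms(4) by auto
  have "of_int m * (of_int v * eta) + al * (of_int u * y) = of_int (v * m) * eta + of_int u * (y * al)"
    by (simp add: mult_ac)
  also have "\<dots> = Trib (u * P) (u * Q + v * m) 0"
    unfolding assms(3) by (simp add: of_int_trib times_trib_def plus_trib_def eta_def algebra_simps)
  also have "\<dots> = eta - of_int (- u * P)"
    by (simp add: uv of_int_trib eta_def minus_trib_def)
  finally show ?thesis
    using square_class[OF assms(1,2)] that by metis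
qed

section \<open>The curve \<open>y^2 = 2(x^3 + x^2 - x + 1)\<close> over the rationals\<close>

text \<open>The name refers to the conductor: \<open>x = 2 X - 1\<close>, \<open>y = 4 V + 2\<close>
  turns the curve into \<open>V^2 + V = X^3 - X^2\<close>, of conductor 11.\<close>

definition g11 :: "int \<Rightarrow> int \<Rightarrow> int" where
  "g11 p q = p ^ 3 + p\<^sup>2 * q - p * q\<^sup>2 + q ^ 3"

lemma nrm_linear: "nrm (Trib p q 0) = g11 p q"
  by (simp add: nrm_def cof_def g11_def power2_eq_square power3_eq_cube algebra_simps)

lemma g11_coprime: "coprime p q \<Longrightarrow> coprime (g11 p q) q"
proof -
  assume "coprime p q"
  then have "coprime (p ^ 3) q" by simp
  moreover have "g11 p q = p ^ 3 + (p\<^sup>2 - p * q + q\<^sup>2) * q"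
    by (simp add: g11_def power2_eq_square power3_eq_cube algebra_simps)
  ultimately show ?thesis
    by (metis coprime_iff_gcd_eq_1 gcd.commute gcd_add_mult mult.commute add.commute)
qed

text \<open>\<open>q\<close> and \<open>g11 p q\<close> are coprime; apart from one factor 2, which
  belongs to exactly one of them, both are squares.\<close>

lemma curve11_numeric:
  assumes "coprime p q" "0 < q" "2 * q * g11 p q = r\<^sup>2"
  obtains e m where "0 < e" "0 < m" "q = 2 * e\<^sup>2" "g11 p q = m\<^sup>2"
    | e m where "0 < e" "0 < m" "q = e\<^sup>2" "g11 p q = 2 * m\<^sup>2"
proof -
  have "g11 p q \<noteq> 0"
    using nrm_eq_0[of "Trib p q 0"] \<open>0 < q\<close> by (simp add: nrm_linear zero_trib_def)
  then have "r \<noteq> 0"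
    using assms by auto
  then have "0 < 2 * q * g11 p q"
    using assms by simp
  then have g: "0 < g11 p q"
    by (rule zero_less_mult_pos) (use assms(2) in simp)
  have "even r"
    using assms(3) by (metis dvd_mult2 dvd_triv_left even_power)
  then obtain r' where r': "r = 2 * r'" by (elim evenE)
  then have qg: "q * g11 p q = 2 * r'\<^sup>2"
    using assms(3) by (simp add: power2_eq_square)
  have cop: "coprime q (g11 p q)"
    using g11_coprime[OF assms(1)] by (simp add: coprime_commute)
  show ?thesis
  proof (cases "even q")
    case True
    then obtain q' where q': "q = 2 * q'" by (elim evenE)
    then have "coprime q' (g11 p q)" "q' * g11 p q = r'\<^sup>2"
      using cop qg by auto
    then show ?thesis
      using coprime_mult_eq_square[of q' "g11 p q" r'] that(1) q' assms(2) g by auto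
  next
    case False
    then have "even (g11 p q)"
      using qg by (metis dvd_triv_left even_mult_iff)
    then obtain n where n: "g11 p q = 2 * n" by (elim evenE)
    then have "coprime q n" "q * n = r'\<^sup>2"
      using cop qg by auto
    then show ?thesis
      using coprime_mult_eq_square[of q n r'] that(2) n assms(2) g by auto
  qed
qed

text \<open>
  The descent keeps track of points whose abscissa, written as \<open>x / (2 e^2)\<close>, satisfies: \<open>2(x / (2 e^2) + eta)\<close> is a
  square in the cubic field.
\<close>

definition X11 :: "int \<Rightarrow> int \<Rightarrow> bool" where
  "X11 x e \<longleftrightarrow> 0 < e \<and> (\<exists>d. d\<^sup>2 = Trib x (2 * e\<^sup>2) 0)"

lemma X11_even_denominator:
  assumes "coprime p q" "0 < e" "0 < m" "q = 2 * e\<^sup>2" "g11 p q = m\<^sup>2"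
  shows "X11 p e"
proof -
  have "odd p"
    using assms(1,4) by (metis coprime_common_divisor dvd_triv_left odd_one)
  have "coprime (m\<^sup>2) q"
    using g11_coprime[OF assms(1)] assms(5) by simp
  then have "coprime q m"
    by (simp add: coprime_commute)
  then consider d where "Trib p q 0 = d\<^sup>2" | d where "Trib p q 0 = eta * d\<^sup>2"
    using int_trib_square_class_linear[of "Trib p q 0" m 1 p q] assms by (auto simp: nrm_linear)
  then show ?thesis
  proof cases
    case 1
    then show ?thesis
      using assms by (auto simp: X11_def intro!: exI[of _ d])
  next
    \<comment> \<open>Parity excludes the class of \<open>eta\<close>: if the last coordinate of
      \<open>eta * d^2\<close> vanishes, its first coordinate is even.\<close>
    case (2 d)
    obtain a b c where "d = Trib a b c" by (cases d)
    then have "p = b\<^sup>2 + 2 * a * c + 2 * b * c + 2 * c\<^sup>2"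
      "2 * (a * b + b * c + c\<^sup>2) + (b\<^sup>2 + 2 * a * c + 2 * b * c + 2 * c\<^sup>2) = 0"
      using 2 by (simp_all add: trib_square eta_times)
    then have "p = - 2 * (a * b + b * c + c\<^sup>2)"
      by linarith
    then show ?thesis
      using \<open>odd p\<close> by simp
  qed
qed

lemma X11_square_denominator:
  assumes "coprime p q" "0 < e" "0 < m" "q = e\<^sup>2" "g11 p q = 2 * m\<^sup>2"
  shows "X11 (2 * p) e"
proof -
  have "even (g11 p q)"
    using assms(5) by simp
  then have "even (p + q)"
    by (cases "even p"; cases "even q") (simp_all add: g11_def)
  then have odd: "odd p" "odd q"
    using assms(1) by (metis coprime_common_divisor even_add odd_one)+
  \<comment> \<open>Dividing by \<open>1 + eta\<close>, of norm 2, leaves the square norm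
    \<open>m^2\<close>.\<close>
  obtain al where al: "(1 + eta) * al = Trib p q 0"
    using even_nrm_imp_dvd[of "Trib p q 0"] assms(5) nrm_linear by (metis dvd_triv_left)
  have "2 * nrm al = 2 * m\<^sup>2"
    using arg_cong[OF al, of nrm] by (simp add: nrm_mult nrm_one_plus_eta nrm_linear assms(5))
  moreover have "coprime (2 * m\<^sup>2) q"
    using g11_coprime[OF assms(1)] assms(5) by simp
  then have "coprime q m"
    by (simp add: coprime_commute)
  ultimately consider d where "al = d\<^sup>2" | d where "al = eta * d\<^sup>2"
    using int_trib_square_class_linear[OF _ _ al, of m] assms(3) by auto
  then show ?thesis
  proof cases
    case (1 d)
    \<comment> \<open>By \<open>(1 + eta)^3 = 2 eta^4\<close> the square of \<open>w\<close> is
      \<open>2 (1 + eta)\<close>, so \<open>w * d\<close> is a square root of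
      \<open>2 (p + q eta)\<close>.\<close>
    define w where "w = (1 + eta)\<^sup>2 * eta_inv\<^sup>2"
    have "w\<^sup>2 = 2 * (1 + eta)"
      by (simp add: w_def power2_eq_square eta_def eta_inv_def trib_arith numeral_trib)
    then have "(w * d)\<^sup>2 = 2 * Trib p q 0"
      by (simp only: power_mult_distrib al[symmetric] 1 mult.assoc)
    also have "\<dots> = Trib (2 * p) (2 * e\<^sup>2) 0"
      by (simp add: numeral_trib times_trib_def assms(4))
    finally show ?thesis
      using assms(2) by (auto simp: X11_def)
  next
    case (2 d)
    obtain a b c where d: "d = Trib a b c" by (cases d)
    define A B C where "A = a\<^sup>2 + 2 * b * c + c\<^sup>2" and "B = a * b + b * c + c\<^sup>2"
      and "C = b\<^sup>2 + 2 * a * c + 2 * b * c + 2 * c\<^sup>2"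
    have "al = Trib C (A + C) (2 * B + C)"
      using 2 by (simp add: d trib_square eta_times A_def B_def C_def)
    then have "p = 2 * B + 2 * C"
      using al by (simp add: one_trib_def eta_def plus_trib_def times_trib_def)
    then show ?thesis
      using odd by simp
  qed
qed

text \<open>
  With \<open>d = a + b eta + c eta^2\<close>, multiplication by \<open>p/q + eta\<close> where \<open>p/q = -(b + c)/c\<close> removes the \<open>eta^2\<close> term
  of \<open>d\<close>, so \<open>p/q\<close> is the abscissa of a point whose double is the given one.
\<close>

lemma X11_halve:
  assumes "X11 x e"
  obtains p q k where "0 < q" "coprime p q" "2 * e\<^sup>2 = k\<^sup>2 * q * g11 p q"
    "4 * x = k\<^sup>2 * (p ^ 4 + 2 * p\<^sup>2 * q\<^sup>2 - 8 * p * q ^ 3 - 3 * q ^ 4)"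
proof -
  obtain d where "0 < e" and d: "d\<^sup>2 = Trib x (2 * e\<^sup>2) 0"
    using assms by (auto simp: X11_def)
  obtain a b c where d_eq: "d = Trib a b c" by (cases d)
  have x: "x = a\<^sup>2 + 2 * b * c + c\<^sup>2" and e: "e\<^sup>2 = a * b + b * c + c\<^sup>2"
    and z: "b\<^sup>2 + 2 * a * c + 2 * b * c + 2 * c\<^sup>2 = 0"
    using d by (simp_all add: d_eq trib_square)
  have "c \<noteq> 0"
  proof
    assume "c = 0"
    then have "b = 0" using z by simp
    then show False using e \<open>c = 0\<close> \<open>0 < e\<close> by simp
  qed
  obtain p q t where qpt: "- (b + c) = p * t" "c = q * t" "0 < q" "coprime p q" "t \<noteq> 0"
    by (rule reduced_fraction[OF \<open>c \<noteq> 0\<close>, of "- (b + c)"])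
  have "(b + c)\<^sup>2 = - c * (2 * a + c)"
    using z by (simp add: power2_eq_square algebra_simps)
  moreover have "(b + c)\<^sup>2 = (p * t)\<^sup>2"
    using qpt(1) by (metis power2_minus)
  ultimately have "t * (p\<^sup>2 * t) = t * (- q * (2 * a + q * t))"
    using qpt(2) by (simp add: power2_eq_square algebra_simps)
  then have pt: "p\<^sup>2 * t = - q * (2 * a + q * t)"
    using qpt(5) by (metis mult_left_cancel)
  then have "q dvd p\<^sup>2 * t"
    by simp
  then have "q dvd t"
    \<comment> \<open>Divisibility of \<open>t\<close> by \<open>q\<close> makes \<open>2 a\<close>,
      \<open>b\<close> and \<open>c\<close> equal to \<open>k\<close> times quadratic forms in
      \<open>p\<close> and \<open>q\<close>.\<close>
    using qpt(4) by (metis coprime_commute coprime_dvd_mult_right_iff coprime_power_right_iff)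
  then obtain k where t: "t = q * k" by (elim dvdE)
  have "q * (p\<^sup>2 * k) = q * (- (2 * a + q\<^sup>2 * k))"
    using pt by (simp add: t power2_eq_square algebra_simps)
  then have "p\<^sup>2 * k = - (2 * a + q\<^sup>2 * k)"
    using qpt(3) by (metis mult_left_cancel less_irrefl)
  then have a: "2 * a = - k * (p\<^sup>2 + q\<^sup>2)"
    by (simp add: algebra_simps)
  have c: "c = q\<^sup>2 * k"
    using qpt(2) by (simp add: t power2_eq_square)
  have b: "b = - q * (p + q) * k"
    using qpt(1) by (simp add: t c power2_eq_square algebra_simps)
  \<comment> \<open>Dividing this identity into the next one gives the duplication formula: the
    double has abscissa
    \<open>(p^4 + 2 p^2 q^2 - 8 p q^3 - 3 q^4) / (4 * q * g11 p q)\<close>.\<close>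
  have "2 * e\<^sup>2 = 2 * a * b + 2 * b * c + 2 * c\<^sup>2"
    by (simp add: e)
  also have "\<dots> = k\<^sup>2 * q * g11 p q"
    unfolding a b c g11_def by (simp add: power2_eq_square power3_eq_cube algebra_simps)
  finally have 1: "2 * e\<^sup>2 = k\<^sup>2 * q * g11 p q" .
  have "4 * x = (2 * a)\<^sup>2 + 8 * b * c + 4 * c\<^sup>2"
    by (simp add: x power2_eq_square)
  also have "\<dots> = k\<^sup>2 * (p ^ 4 + 2 * p\<^sup>2 * q\<^sup>2 - 8 * p * q ^ 3 - 3 * q ^ 4)"
    unfolding a b c by (simp add: power2_eq_square power3_eq_cube power4_eq_xxxx algebra_simps)
  finally show ?thesis
    using that[OF qpt(3,4) 1] by blast
qed

lemma dvd_of_square_mult: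
  fixes k n s :: int
  assumes "k\<^sup>2 * n = s\<^sup>2" "k \<noteq> 0"
  obtains r where "s = k * r" "n = r\<^sup>2"
proof -
  have "k\<^sup>2 dvd s\<^sup>2"
    using assms(1) by (metis dvd_triv_left)
  then obtain r where r: "s = k * r"
    by (auto elim: dvdE)
  then have "n = r\<^sup>2"
    using assms by (simp add: power_mult_distrib)
  with r show ?thesis
    using that by blast
qed

lemma square_mult_square_mult_square_eq:
  fixes e e' k m :: int
  assumes "e\<^sup>2 = (k * e' * m)\<^sup>2" "0 < e'" "0 < m" "k \<noteq> 0" "0 < e"
  shows "e' < e \<or> e' = e \<and> k\<^sup>2 = 1 \<and> m = 1"
proof -
  have "\<bar>e\<bar> = \<bar>k * e' * m\<bar>"
    using assms(1) by (simp add: power2_eq_iff abs_eq_iff)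
  then have e: "e = e' * (\<bar>k\<bar> * m)"
    using assms by (simp add: abs_mult mult_ac)
  have km: "1 \<le> \<bar>k\<bar> * m"
    using assms by (simp add: int_one_le_iff_zero_less)
  show ?thesis
  proof (cases "\<bar>k\<bar> * m = 1")
    case True
    then have "\<bar>k\<bar> = 1" "m = 1"
      using assms(3) by (simp_all add: zmult_eq_1_iff)
    then show ?thesis
      using e by (metis mult.right_neutral power2_abs power_one)
  next
    case False
    then have "e' * 1 < e' * (\<bar>k\<bar> * m)"
      using km assms by (intro mult_strict_left_mono) auto
    then show ?thesis
      using e by simp
  qed
qed

lemma g11_eq_2_pos:
  assumes "g11 p q = 2" "0 < p" "0 < q"
  shows "p = 1 \<and> q = 1"
proof -
  have "g11 p q = (p + q) * (p - q)\<^sup>2 + 2 * (p * (p * q))"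
    by (simp add: g11_def power2_eq_square power3_eq_cube algebra_simps)
  moreover have "0 \<le> (p + q) * (p - q)\<^sup>2"
    using assms by simp
  ultimately have "p * (p * q) \<le> 1"
    using assms(1) by linarith
  moreover have "0 < p * (p * q)"
    using assms by simp
  ultimately have "p * (p * q) = 1" by linarith
  then show ?thesis
    using assms by (simp add: zmult_eq_1_iff)
qed

text \<open>The quartic is the numerator of the abscissa of the double, so a halving that keeps
  \<open>e\<close> and has \<open>p <= 0\<close> starts from a positive abscissa.\<close>

lemma g11_eq_2_nonpos:
  assumes "g11 p q = 2" "p \<le> 0" "0 < q"
  shows "0 < p ^ 4 + 2 * p\<^sup>2 * q\<^sup>2 - 8 * p * q ^ 3 - 3 * q ^ 4"
proof -
  define k where "k = - p"
  have k: "0 \<le> k" and p: "p = - k"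
    using assms by (simp_all add: k_def)
  have g: "k * k * (q - k) + k * (q * q) + q * (q * q) = 2"
    using assms(1) by (simp add: p g11_def power2_eq_square power3_eq_cube algebra_simps)
  \<comment> \<open>For \<open>k < q\<close> all summands of \<open>g\<close> are nonnegative, so
    \<open>q = 1\<close> and \<open>k = 0\<close>, where the form has value 1.\<close>
  have "q \<le> k"
  proof (rule ccontr)
    assume "\<not> q \<le> k"
    then have kq: "k < q" by simp
    then have "0 \<le> k * k * (q - k)" "0 \<le> k * (q * q)"
      using k assms(3) by simp_all
    then have "q * (q * q) \<le> 2"
      using g by linarith
    have "q = 1"
    proof (rule ccontr)
      assume "q \<noteq> 1"
      then have "2 \<le> q" using assms(3) by linarith
      then have "2 * 2 \<le> q * q"
        by (intro mult_mono) auto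
      then have "2 * (2 * 2) \<le> q * (q * q)"
        using \<open>2 \<le> q\<close> by (intro mult_mono) auto
      then show False
        using \<open>q * (q * q) \<le> 2\<close> by simp
    qed
    moreover have "k = 0"
      using kq k calculation by simp
    ultimately show False
      using g by simp
  qed
  then have qk: "q\<^sup>2 \<le> k\<^sup>2"
    using assms(3) by (intro power_mono) auto
  then have "0 \<le> (k\<^sup>2 - q\<^sup>2) * (k\<^sup>2 + 3 * q\<^sup>2)"
    by (intro mult_nonneg_nonneg) auto
  moreover have "0 < k * q ^ 3"
    using \<open>q \<le> k\<close> assms(3) by simp
  moreover have "p ^ 4 + 2 * p\<^sup>2 * q\<^sup>2 - 8 * p * q ^ 3 - 3 * q ^ 4
      = (k\<^sup>2 - q\<^sup>2) * (k\<^sup>2 + 3 * q\<^sup>2) + 8 * (k * q ^ 3)"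
    by (simp add: p power2_eq_square power3_eq_cube power4_eq_xxxx algebra_simps)
  ultimately show ?thesis
    by linarith
qed

text \<open>
  The bound \<open>e' \<le> e\<close> is strict unless \<open>g11 p q = 2\<close>; the sign argument in \<open>X11_abs_eq\<close> excludes that two
  consecutive halvings are both nontrivial and keep \<open>e\<close>.
\<close>

lemma X11_descent:
  assumes "X11 x e"
  obtains p q k x' e' where "0 < q" "coprime p q" "2 * e\<^sup>2 = k\<^sup>2 * q * g11 p q"
    "4 * x = k\<^sup>2 * (p ^ 4 + 2 * p\<^sup>2 * q\<^sup>2 - 8 * p * q ^ 3 - 3 * q ^ 4)"
    "X11 x' e'" "x' * q = 2 * p * e'\<^sup>2" "e' < e \<or> e' = e \<and> k\<^sup>2 = 1 \<and> g11 p q = 2"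
proof -
  obtain p q k where pqk: "0 < q" "coprime p q" and e: "2 * e\<^sup>2 = k\<^sup>2 * q * g11 p q"
    and x: "4 * x = k\<^sup>2 * (p ^ 4 + 2 * p\<^sup>2 * q\<^sup>2 - 8 * p * q ^ 3 - 3 * q ^ 4)"
    by (rule X11_halve[OF assms])
  have "0 < e"
    using assms by (simp add: X11_def)
  then have "k \<noteq> 0"
    using e by auto
  have "k\<^sup>2 * (2 * q * g11 p q) = (2 * e)\<^sup>2"
    using e by (simp add: power_mult_distrib algebra_simps)
  then obtain r where "2 * q * g11 p q = r\<^sup>2"
    using dvd_of_square_mult \<open>k \<noteq> 0\<close> by metis
  from curve11_numeric[OF pqk(2,1) this] show ?thesis
  proof cases
    case (1 e' m)
    have "e\<^sup>2 = (k * e' * m)\<^sup>2"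
      using e 1 by (simp add: power_mult_distrib)
    moreover have "\<not> (k\<^sup>2 = 1)"
    proof
      assume "k\<^sup>2 = 1"
      then have "even (p ^ 4 + 2 * p\<^sup>2 * q\<^sup>2 - 8 * p * q ^ 3 - 3 * q ^ 4)"
        using x by (metis even_mult_iff even_numeral mult_1)
      then show False
        using 1(3) pqk(2) by (auto simp: coprime_commute dest: coprime_common_divisor)
    qed
    ultimately have "e' < e"
      using square_mult_square_mult_square_eq[of e k e' m] 1 \<open>k \<noteq> 0\<close> \<open>0 < e\<close> by auto
    then show ?thesis
      using that[OF pqk e x X11_even_denominator[OF pqk(2) 1]] 1(3) by (simp add: mult_ac)
  next
    case (2 e' m)
    have "e\<^sup>2 = (k * e' * m)\<^sup>2"
      using e 2 by (simp add: power_mult_distrib)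
    then have "e' < e \<or> e' = e \<and> k\<^sup>2 = 1 \<and> g11 p q = 2"
      using square_mult_square_mult_square_eq[of e k e' m] 2 \<open>k \<noteq> 0\<close> \<open>0 < e\<close> by auto
    then show ?thesis
      using that[OF pqk e x X11_square_denominator[OF pqk(2) 2]] 2(3) by (simp add: mult_ac)
  qed
qed

text \<open>\<open>|x| = 2 e^2\<close> means abscissa 1 or -1, a property that passes from the half
  point to its double. What remains is a stalled halving with \<open>p <= 0\<close>.\<close>

lemma X11_trivial_or_pos:
  assumes X: "X11 x e" and smaller: "\<And>x' e'. X11 x' e' \<Longrightarrow> e' < e \<Longrightarrow> \<bar>x'\<bar> = 2 * e'\<^sup>2"
  obtains "\<bar>x\<bar> = 2 * e\<^sup>2"
    | x' where "0 < x" "x' \<le> 0" "X11 x' e" "\<bar>x'\<bar> = 2 * e\<^sup>2 \<Longrightarrow> \<bar>x\<bar> = 2 * e\<^sup>2"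
proof -
  obtain p q k x' e' where q: "0 < q" and pq: "coprime p q" and e: "2 * e\<^sup>2 = k\<^sup>2 * q * g11 p q"
    and x: "4 * x = k\<^sup>2 * (p ^ 4 + 2 * p\<^sup>2 * q\<^sup>2 - 8 * p * q ^ 3 - 3 * q ^ 4)"
    and x': "X11 x' e'" "x' * q = 2 * p * e'\<^sup>2"
    and e': "e' < e \<or> e' = e \<and> k\<^sup>2 = 1 \<and> g11 p q = 2"
    by (rule X11_descent[OF X])
  have "0 < e'"
    using x'(1) by (simp add: X11_def)
  have unit: "\<bar>x\<bar> = 2 * e\<^sup>2" if "\<bar>p\<bar> = 1" "q = 1"
  proof -
    from \<open>\<bar>p\<bar> = 1\<close> consider "p = 1" | "p = -1" by linarith
    then show ?thesis
      using e x that(2) by cases (simp_all add: g11_def abs_mult)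
  qed
  have trivial: "\<bar>x\<bar> = 2 * e\<^sup>2" if "\<bar>x'\<bar> = 2 * e'\<^sup>2"
  proof -
    have "\<bar>x'\<bar> * q = \<bar>p\<bar> * (2 * e'\<^sup>2)"
      using arg_cong[OF x'(2), of abs] q by (simp add: abs_mult mult_ac)
    then have "q = \<bar>p\<bar>"
      using that \<open>0 < e'\<close> by simp
    then have "q = 1"
      using pq q by (metis abs_of_pos coprime_abs_left_iff coprime_self zdvd1_eq dvd_refl is_unit_gcd)
    then show ?thesis
      using unit \<open>q = \<bar>p\<bar>\<close> by simp
  qed
  from e' show ?thesis
  proof
    assume "e' < e"
    then show ?thesis
      using that(1) trivial smaller x'(1) by blast
  next
    assume *: "e' = e \<and> k\<^sup>2 = 1 \<and> g11 p q = 2"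
    show ?thesis
    proof (cases "0 < p")
      case True
      then show ?thesis
        using that(1) unit g11_eq_2_pos[of p q] * q by simp
    next
      case False
      then have "0 < 4 * x"
        using g11_eq_2_nonpos[of p q] * q x by simp
      moreover have "x' * q \<le> 0"
        using False x'(2) by (simp add: mult_nonpos_nonneg)
      then have "x' \<le> 0"
        using q by (simp add: mult_le_0_iff)
      ultimately show ?thesis
        using that(2)[of x'] x'(1) trivial * by simp
    qed
  qed
qed

lemma X11_abs_eq:
  assumes "X11 x e"
  shows "\<bar>x\<bar> = 2 * e\<^sup>2"
  using assms
proof (induction "nat e" arbitrary: x e rule: less_induct)
  case less
  have smaller: "\<bar>x'\<bar> = 2 * e'\<^sup>2" if "X11 x' e'" "e' < e" for x' e'
    using less.hyps[of e' x'] that by (auto simp: X11_def)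
  consider "\<bar>x\<bar> = 2 * e\<^sup>2"
    | x' where "x' \<le> 0" "X11 x' e" "\<bar>x'\<bar> = 2 * e\<^sup>2 \<Longrightarrow> \<bar>x\<bar> = 2 * e\<^sup>2"
    by (rule X11_trivial_or_pos[OF less.prems smaller]) blast+
  then show ?case
  proof cases
    case (2 x')
    \<comment> \<open>A second stalled halving would make \<open>x'\<close> positive, against
      \<open>x' <= 0\<close>.\<close>
    consider "\<bar>x'\<bar> = 2 * e\<^sup>2" | "0 < x'"
      by (rule X11_trivial_or_pos[OF 2(2) smaller]) blast+
    then show ?thesis
      using 2 by cases auto
  qed
qed

lemma curve11_integer_solutions:
  assumes "coprime p q" "0 < q" "2 * q * g11 p q = r\<^sup>2"
  shows "q = 1 \<and> \<bar>p\<bar> = 1"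
proof -
  have "\<bar>p\<bar> = q"
  proof (rule curve11_numeric[OF assms])
    fix e m
    assume "0 < e" "0 < m" "q = 2 * e\<^sup>2" "g11 p q = m\<^sup>2"
    then show ?thesis
      using X11_abs_eq[OF X11_even_denominator[OF assms(1)]] by simp
  next
    fix e m
    assume "0 < e" "0 < m" "q = e\<^sup>2" "g11 p q = 2 * m\<^sup>2"
    then show ?thesis
      using X11_abs_eq[OF X11_square_denominator[OF assms(1)]] by (simp add: abs_mult)
  qed
  then show ?thesis
    using assms by (metis abs_of_pos coprime_abs_left_iff coprime_self zdvd1_eq dvd_refl is_unit_gcd)
qed

section \<open>The curve \<open>w^2 = s^3 + s^2 + 3 s - 1\<close> over the rationals\<close>

text \<open>The name refers to the conductor 44 of the curve of this section.\<close>

definition h44 :: "int \<Rightarrow> int \<Rightarrow> int" where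
  "h44 p q = p ^ 3 + p\<^sup>2 * q + 3 * p * q\<^sup>2 - q ^ 3"

lemma nrm_Trib_h44: "nrm (Trib (- q) 0 p) = h44 p q"
  by (simp add: nrm_def cof_def h44_def power2_eq_square power3_eq_cube algebra_simps)

lemma h44_coprime: "coprime p q \<Longrightarrow> coprime (h44 p q) q"
proof -
  assume "coprime p q"
  then have "coprime (p ^ 3) q" by simp
  moreover have "h44 p q = p ^ 3 + (p\<^sup>2 + 3 * p * q - q\<^sup>2) * q"
    by (simp add: h44_def power2_eq_square power3_eq_cube algebra_simps)
  ultimately show ?thesis
    by (metis coprime_iff_gcd_eq_1 gcd.commute gcd_add_mult mult.commute add.commute)
qed

text \<open>In \<open>(1 - eta) (p eta^2 - q) = - (p + q) + (q - p) eta\<close> the coefficient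
  \<open>q - p\<close> has to be invertible modulo \<open>m\<close>. It is, because
  \<open>h44 q q = 4 q^3\<close>.\<close>

lemma coprime_diff_of_dvd_h44:
  assumes "coprime p q" "m dvd h44 p q" "odd m"
  shows "coprime (q - p) m"
proof (rule coprimeI)
  fix d
  assume d: "d dvd q - p" "d dvd m"
  have "d dvd h44 p q"
    using d(2) assms(2) dvd_trans by blast
  moreover have "4 * q ^ 3 = h44 p q + (q - p) * (p\<^sup>2 + 2 * p * q + 5 * q\<^sup>2)"
    by (simp add: h44_def power2_eq_square power3_eq_cube algebra_simps)
  ultimately have dvd: "d dvd 4 * q ^ 3"
    using d(1) by simp
  have "odd d"
    using assms(3) d(2) dvd_trans by blast
  then have "coprime d (2 ^ 2)"
    by (simp only: coprime_power_right_iff) simp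
  then have "d dvd q ^ 3"
    using dvd by (simp add: coprime_dvd_mult_right_iff)
  moreover have "coprime (q - p) q"
    using assms(1) by (metis coprime_commute coprime_iff_gcd_eq_1 gcd_diff2)
  then have "coprime d q"
    using d(1) by (meson coprime_divisors dvd_refl)
  then have "coprime d (q ^ 3)"
    by simp
  ultimately show "is_unit d"
    by (meson coprime_common_divisor dvd_refl)
qed

lemma int_trib_square_class_h44:
  assumes "nrm al = m\<^sup>2" "m \<noteq> 0" "y * al = Trib (- q) 0 p" "coprime (q - p) m"
  obtains d where "al = d\<^sup>2" | d where "al = eta * d\<^sup>2"
proof -
  obtain u v where uv: "u * (q - p) + v * m = 1"
    using bezout_int[of "q - p" m] assms(4) by auto
  have "of_int m * (of_int v * eta) + al * (of_int u * (1 - eta) * y)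
    = of_int (v * m) * eta + of_int u * ((1 - eta) * (y * al))"
    by (simp add: mult_ac)
  also have "\<dots> = Trib (- u * (q + p)) (u * (q - p) + v * m) 0"
    unfolding assms(3) by (simp add: of_int_trib trib_arith eta_def algebra_simps)
  also have "\<dots> = eta - of_int (u * (q + p))"
    by (simp add: uv of_int_trib eta_def minus_trib_def)
  finally show ?thesis
    using square_class[OF assms(1,2)] that by metis
qed

text \<open>
  Points with abscissa \<open>x / e^2\<close> for which \<open>(x / e^2) eta^2 - 1\<close> is a square in the cubic field.
\<close>

definition X44 :: "int \<Rightarrow> int \<Rightarrow> bool" where
  "X44 x e \<longleftrightarrow> 0 < e \<and> (\<exists>d. d\<^sup>2 = Trib (- (e\<^sup>2)) 0 x)"

lemma curve44_numeric:
  assumes "coprime p q" "0 < q" "q * h44 p q = r\<^sup>2"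
  obtains e m where "0 < e" "0 < m" "q = e\<^sup>2" "h44 p q = m\<^sup>2"
proof -
  have "h44 p q \<noteq> 0"
    using nrm_eq_0[of "Trib (- q) 0 p"] \<open>0 < q\<close> by (simp add: nrm_Trib_h44 zero_trib_def)
  then have "r \<noteq> 0"
    using assms by auto
  then have "0 < q * h44 p q"
    using assms by simp
  then have "0 < h44 p q"
    by (rule zero_less_mult_pos) (use assms(2) in simp)
  then show ?thesis
    using coprime_mult_eq_square[of q "h44 p q" r] h44_coprime[OF assms(1)] assms that
    by (metis coprime_commute)
qed

lemma X44_odd_sum:
  assumes "coprime p q" "odd (p + q)" "0 < e" "0 < m" "q = e\<^sup>2" "h44 p q = m\<^sup>2"
  shows "X44 p e"
proof -
  have "odd (h44 p q)"
    using assms(2) by (cases "even p") (simp_all add: h44_def)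
  then have "odd m"
    using assms(6) by simp
  then have "coprime (q - p) m"
    using coprime_diff_of_dvd_h44[OF assms(1), of m] assms(6) by simp
  then consider d where "Trib (- q) 0 p = d\<^sup>2" | d where "Trib (- q) 0 p = eta * d\<^sup>2"
    using int_trib_square_class_h44[of "Trib (- q) 0 p" m 1 q p] assms by (auto simp: nrm_Trib_h44)
  then show ?thesis
  proof cases
    case (1 d)
    then show ?thesis
      using assms by (auto simp: X44_def intro!: exI[of _ d])
  next
    \<comment> \<open>The first and last coordinates of \<open>eta * d^2\<close> differ by an even
      number, against \<open>p + q\<close> odd.\<close>
    case (2 d)
    obtain a b c where "d = Trib a b c" by (cases d)
    then have "p + q = 2 * (a * b + b * c + c\<^sup>2)"
      using 2 by (simp add: trib_square eta_times)
    then show ?thesis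
      using assms(2) by simp
  qed
qed

text \<open>Exactly two of the three squares are odd, so the sum is 2 modulo 4.\<close>

lemma sum_three_squares_neq_4_mult:
  fixes a c e b :: int
  assumes "odd (a + c)" "odd e"
  shows "a\<^sup>2 + c\<^sup>2 + e\<^sup>2 \<noteq> 4 * b"
proof
  assume *: "a\<^sup>2 + c\<^sup>2 + e\<^sup>2 = 4 * b"
  have odd: "\<exists>k. x\<^sup>2 = 4 * k + 1" if x: "odd x" for x :: int
  proof -
    obtain k where "x = 2 * k + 1"
      using x by (rule oddE)
    then have "x\<^sup>2 = 4 * (k * k + k) + 1"
      by (simp add: power2_eq_square algebra_simps)
    then show ?thesis by blast
  qed
  have even: "\<exists>k. x\<^sup>2 = 4 * k" if "even x" for x :: int
    using that by (elim evenE) (auto simp: power2_eq_square)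
  show False
    using assms(1) * odd[of a] odd[of c] odd[OF assms(2)] even[of a] even[of c]
    by (cases "even a") (auto, presburger+)
qed

lemma X44_even_sum:
  assumes "coprime p q" "even (p + q)" "0 < e" "0 < m" "q = e\<^sup>2" "h44 p q = m\<^sup>2"
  shows "X44 p e"
proof -
  have odd: "odd p" "odd q"
    using assms(1,2) by (metis coprime_common_divisor even_add odd_one)+
  then obtain k where "p - q = 2 * k"
    by (metis even_diff evenE odd_add)
  then have p: "p = q + 2 * k" by simp
  \<comment> \<open>The quotient of \<open>p eta^2 - q\<close> by \<open>eta^2 - 1\<close>, which
    has norm 4 and is the square of \<open>eta^2 - eta\<close>.\<close>
  define al where "al = Trib (p - k) k 0"
  have al: "(eta\<^sup>2 - 1) * al = Trib (- q) 0 p"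
    by (simp add: al_def p power2_eq_square eta_def trib_arith)
  have nrm4: "nrm (eta\<^sup>2 - 1) = 4"
    by (simp add: power2_eq_square eta_def trib_arith nrm_def cof_def)
  have four: "4 * nrm al = m\<^sup>2"
    using arg_cong[OF al, of nrm] by (simp add: nrm_mult nrm4 nrm_Trib_h44 assms(6))
  then have "even m"
    by (metis dvd_mult2 even_numeral even_power)
  then obtain m' where m: "m = 2 * m'" by (elim evenE)
  have al_m: "nrm al = m'\<^sup>2"
    using four by (simp add: m)
  have "odd (nrm al)"
    using odd(1) unfolding al_def nrm_linear g11_def by (cases "even k") simp_all
  then have "odd m'"
    by (simp add: al_m)
  moreover have "m' dvd h44 p q"
    by (simp add: assms(6) m power2_eq_square)
  ultimately have "coprime (q - p) m'"
    using coprime_diff_of_dvd_h44[OF assms(1)] by blast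
  then consider d where "al = d\<^sup>2" | d where "al = eta * d\<^sup>2"
    using int_trib_square_class_h44[OF al_m _ al] assms(4) m by auto
  then show ?thesis
  proof cases
    case (1 d)
    have "((eta\<^sup>2 - eta) * d)\<^sup>2 = (eta\<^sup>2 - eta)\<^sup>2 * al"
      by (simp add: 1 power_mult_distrib)
    also have "(eta\<^sup>2 - eta)\<^sup>2 = eta\<^sup>2 - 1"
      by (simp add: power2_eq_square eta_def trib_arith)
    finally show ?thesis
      using assms by (auto simp: X44_def al)
  next
    \<comment> \<open>Comparing coordinates, \<open>b\<close> is even, exactly one of
      \<open>a\<close> and \<open>c\<close> is odd, and \<open>a^2 + c^2 + e^2 = - 2 b c\<close>,
      which fails modulo 4.\<close>
    case (2 d)
    obtain a b c where "d = Trib a b c" by (cases d)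
    then have k: "p - k = b\<^sup>2 + 2 * a * c + 2 * b * c + 2 * c\<^sup>2"
      "k = a\<^sup>2 + 2 * b * c + c\<^sup>2 + (b\<^sup>2 + 2 * a * c + 2 * b * c + 2 * c\<^sup>2)"
      "2 * (a * b + b * c + c\<^sup>2) + (b\<^sup>2 + 2 * a * c + 2 * b * c + 2 * c\<^sup>2) = 0"
      using 2 by (simp_all add: al_def trib_square eta_times)
    have "b\<^sup>2 = 2 * - (a * b + b * c + c\<^sup>2 + a * c + b * c + c\<^sup>2)"
      using k(3) by (simp add: algebra_simps)
    then have "even (b\<^sup>2)" by (metis dvd_triv_left)
    then obtain b' where b: "b = 2 * b'" by (auto elim: evenE)
    have "p = a\<^sup>2 + c\<^sup>2 + 2 * (b * c + (b\<^sup>2 + 2 * a * c + 2 * b * c + 2 * c\<^sup>2))"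
      using k(1,2) by simp
    then have "odd (a + c)"
      using odd(1) by simp
    moreover have "a\<^sup>2 + c\<^sup>2 + e\<^sup>2 = 4 * - (b' * c)"
      using k(1,2) p assms(5) b by (simp add: algebra_simps)
    ultimately show ?thesis
      using sum_three_squares_neq_4_mult[of a c e "- (b' * c)"] odd(2) assms(5) by simp
  qed
qed

lemma X44I:
  assumes "coprime p q" "0 < e" "0 < m" "q = e\<^sup>2" "h44 p q = m\<^sup>2"
  shows "X44 p e"
  using assms X44_odd_sum X44_even_sum by blast

text \<open>If the half point has abscissa \<open>2 j / l - 1\<close>, a common factor 16 cancels in
  the duplication formula and the double has abscissa
  \<open>(j^4 - 2 j^3 l + 2 j l^3) / (l * c44 j l)\<close>.\<close>

definition c44 :: "int \<Rightarrow> int \<Rightarrow> int" where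
  "c44 j l = 2 * j ^ 3 - 2 * j\<^sup>2 * l + 2 * j * l\<^sup>2 - l ^ 3"

lemma X44_halve:
  assumes "X44 x e"
  obtains j l k where "0 < l" "coprime j l" "e\<^sup>2 = k\<^sup>2 * l * c44 j l"
    "x = k\<^sup>2 * (j ^ 4 - 2 * j ^ 3 * l + 2 * j * l ^ 3)"
proof -
  obtain d where "0 < e" and d: "d\<^sup>2 = Trib (- (e\<^sup>2)) 0 x"
    using assms by (auto simp: X44_def)
  obtain a b c where d_eq: "d = Trib a b c" by (cases d)
  have e: "e\<^sup>2 = - (a\<^sup>2 + 2 * b * c + c\<^sup>2)" and z: "a * b + b * c + c\<^sup>2 = 0"
    and x: "x = b\<^sup>2 + 2 * a * c + 2 * b * c + 2 * c\<^sup>2"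
    using d by (simp_all add: d_eq trib_square)
  \<comment> \<open>The vanishing \<open>eta\<close> coordinate of \<open>d^2\<close> defines a
    conic, parametrised below by \<open>j / l = c / (a + c)\<close>.\<close>
  have vb: "(a + c) * b = - (c\<^sup>2)"
    using z by (simp add: algebra_simps)
  have "a + c \<noteq> 0"
  proof
    assume "a + c = 0"
    then have "c = 0" "a = 0" using vb by simp_all
    then show False using e \<open>0 < e\<close> by simp
  qed
  then obtain j l t where jlt: "c = j * t" "a + c = l * t" "0 < l" "coprime j l" "t \<noteq> 0"
    by (rule reduced_fraction)
  have "t * (l * b) = t * (- (j\<^sup>2 * t))"
    using vb[unfolded jlt(2), unfolded jlt(1)] by (simp add: power2_eq_square mult_ac)
  then have lb: "l * b = - (j\<^sup>2 * t)"
    using jlt(5) by (metis mult_left_cancel)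
  then have "l dvd j\<^sup>2 * t"
    by (metis dvd_minus_iff dvd_triv_left)
  then have "l dvd t"
    using jlt(4) by (metis coprime_commute coprime_dvd_mult_right_iff coprime_power_right_iff)
  then obtain k where t: "t = l * k" by (elim dvdE)
  have "l * b = l * (- (j\<^sup>2 * k))"
    using lb by (simp add: t mult_ac)
  then have b: "b = - (j\<^sup>2 * k)"
    using jlt(3) by (metis mult_left_cancel less_irrefl)
  have c: "c = j * l * k"
    using jlt(1) by (simp add: t)
  have a: "a = l\<^sup>2 * k - j * l * k"
    using jlt(2) by (simp add: t c power2_eq_square algebra_simps)
  have "e\<^sup>2 = k\<^sup>2 * l * c44 j l"
    unfolding e a b c c44_def by (simp add: power2_eq_square power3_eq_cube algebra_simps)
  moreover have "x = k\<^sup>2 * (j ^ 4 - 2 * j ^ 3 * l + 2 * j * l ^ 3)"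
    unfolding x a b c by (simp add: power2_eq_square power3_eq_cube power4_eq_xxxx algebra_simps)
  ultimately show ?thesis
    using that jlt(3,4) by blast
qed

text \<open>The half point is \<open>(2 j - l) / l\<close>; for even \<open>l\<close> a factor 2
  cancels in this fraction, hence the separate \<open>h44_even\<close>.\<close>

lemma h44_odd: "h44 (2 * j - l) l = 4 * c44 j l"
  by (simp add: h44_def c44_def power2_eq_square power3_eq_cube algebra_simps)

lemma h44_even: "2 * h44 (j - l) l = c44 j (2 * l)"
  by (simp add: h44_def c44_def power2_eq_square power3_eq_cube algebra_simps)

lemma X44_descent:
  assumes "X44 x e"
  obtains j l k x' e' where "0 < l" "coprime j l" "e\<^sup>2 = k\<^sup>2 * l * c44 j l"
    "x = k\<^sup>2 * (j ^ 4 - 2 * j ^ 3 * l + 2 * j * l ^ 3)"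
    "X44 x' e'" "x' = e'\<^sup>2 \<Longrightarrow> j = l"
    "e' < e \<or> e' = e \<and> k\<^sup>2 = 1 \<and> c44 j l = 1 \<and> l = e\<^sup>2 \<and> x' = 2 * j - l"
proof -
  obtain j l k where jl: "0 < l" "coprime j l" and e: "e\<^sup>2 = k\<^sup>2 * l * c44 j l"
    and x: "x = k\<^sup>2 * (j ^ 4 - 2 * j ^ 3 * l + 2 * j * l ^ 3)"
    by (rule X44_halve[OF assms])
  have "0 < e"
    using assms by (simp add: X44_def)
  then have "k \<noteq> 0"
    using e by auto
  have "k\<^sup>2 * (l * c44 j l) = e\<^sup>2"
    using e by simp
  then obtain r where r: "l * c44 j l = r\<^sup>2"
    using dvd_of_square_mult \<open>k \<noteq> 0\<close> by metis
  show ?thesis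
  proof (cases "even l")
    case True
    then obtain l' where l: "l = 2 * l'" by (elim evenE)
    have "4 * (l' * h44 (j - l') l') = r\<^sup>2"
      unfolding r[symmetric] l h44_even[symmetric] by simp
    then have "even (r\<^sup>2)"
      by (metis dvd_mult2 even_numeral)
    then obtain r' where r': "r = 2 * r'" by (auto elim: evenE)
    have r2: "l' * h44 (j - l') l' = r'\<^sup>2"
      using \<open>4 * (l' * h44 (j - l') l') = r\<^sup>2\<close> by (simp add: r')
    have "coprime j l'"
      using jl(2) l by simp
    then have cop: "coprime (j - l') l'"
      by (metis coprime_iff_gcd_eq_1 gcd_diff1)
    have "0 < l'"
      using jl(1) l by simp
    from curve44_numeric[OF cop this r2]
    obtain e' m where em: "0 < e'" "0 < m" "l' = e'\<^sup>2" "h44 (j - l') l' = m\<^sup>2"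
      by blast
    have "c44 j l = 2 * m\<^sup>2"
      using h44_even[of j l'] em(4) by (simp add: l)
    then have "e\<^sup>2 = ((2 * k) * e' * m)\<^sup>2"
      using e by (simp add: l em(3) power_mult_distrib)
    then have "e' < e \<or> e' = e \<and> (2 * k)\<^sup>2 = 1 \<and> m = 1"
      using square_mult_square_mult_square_eq[of e "2 * k" e' m] em \<open>k \<noteq> 0\<close> \<open>0 < e\<close> by auto
    \<comment> \<open>The doubled \<open>k\<close> rules out equality, so the denominator drops
      strictly.\<close>
    moreover have "even ((2 * k)\<^sup>2)"
      by simp
    then have "(2 * k)\<^sup>2 \<noteq> 1"
      by (metis odd_one)
    moreover have "j = l" if "j - l' = e'\<^sup>2"
      using that em(3) l by simp
    ultimately show ?thesis
      using that[OF jl e x X44I[OF cop em]] by blast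
  next
    case False
    have "l * h44 (2 * j - l) l = (2 * r)\<^sup>2"
      using r by (simp add: h44_odd power_mult_distrib)
    have "coprime (2 * j) l"
      using jl(2) False by simp
    then have cop: "coprime (2 * j - l) l"
      by (metis coprime_iff_gcd_eq_1 gcd_diff1)
    from curve44_numeric[OF cop jl(1) \<open>l * h44 (2 * j - l) l = (2 * r)\<^sup>2\<close>]
    obtain e' m where em: "0 < e'" "0 < m" "l = e'\<^sup>2" "h44 (2 * j - l) l = m\<^sup>2"
      by blast
    have "even (m\<^sup>2)"
      using em(4) by (metis h44_odd dvd_mult2 even_numeral)
    then obtain m' where m': "m = 2 * m'" by (auto elim: evenE)
    have c: "c44 j l = m'\<^sup>2"
      using h44_odd[of j l] em(4) by (simp add: m')
    then have "e\<^sup>2 = (k * e' * m')\<^sup>2"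
      using e by (simp add: em(3) power_mult_distrib)
    then have "e' < e \<or> e' = e \<and> k\<^sup>2 = 1 \<and> m' = 1"
      using square_mult_square_mult_square_eq[of e k e' m'] em m' \<open>k \<noteq> 0\<close> \<open>0 < e\<close> by auto
    then have "e' < e \<or> e' = e \<and> k\<^sup>2 = 1 \<and> c44 j l = 1 \<and> l = e\<^sup>2 \<and> 2 * j - l = 2 * j - l"
      using c em(3) by auto
    moreover have "j = l" if "2 * j - l = e'\<^sup>2"
      using that em(3) by simp
    ultimately show ?thesis
      using that[OF jl e x X44I[OF cop em]] by blast
  qed
qed

text \<open>Used with \<open>l = e^2\<close>: a halving that keeps the denominator starts from
  abscissa at least 1. The equation forces \<open>0 < j <= l\<close>, where the quartic is easy to
  bound.\<close>

lemma c44_eq_1: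
  assumes "c44 j l = 1" "0 < l"
  shows "l \<le> j ^ 4 - 2 * j ^ 3 * l + 2 * j * l ^ 3"
proof -
  have c: "2 * (j * j) * (j - l) + 2 * (j * (l * l)) - l * (l * l) = 1"
    using assms(1) by (simp add: c44_def power2_eq_square power3_eq_cube algebra_simps)
  have l3: "0 < l * (l * l)" "0 < l * l"
    using assms(2) by simp_all
  have "0 < j"
  proof (rule ccontr)
    assume "\<not> 0 < j"
    then have "2 * (j * j) * (j - l) \<le> 0"
      using assms(2) by (intro mult_nonneg_nonpos) auto
    moreover have "j * (l * l) \<le> 0"
      using \<open>\<not> 0 < j\<close> by (intro mult_nonpos_nonneg) auto
    ultimately show False using c l3 by linarith
  qed
  have "j \<le> l"
  proof (rule ccontr)
    assume "\<not> j \<le> l"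
    then have "1 * 1 \<le> (j * j) * (j - l)" "l * (l * l) \<le> j * (l * l)"
      using \<open>0 < j\<close> assms(2) by (intro mult_mono; simp add: int_one_le_iff_zero_less)+
    then show False using c l3 by linarith
  qed
  have "j * j \<le> l * j"
    using \<open>0 < j\<close> \<open>j \<le> l\<close> by (intro mult_right_mono) auto
  then have "0 \<le> l * l + l * j - j * j"
    using l3 by linarith
  then have "0 \<le> (l - j) * (l * l + l * j - j * j)"
    using \<open>j \<le> l\<close> by (intro mult_nonneg_nonneg) auto
  then have "0 \<le> j * ((l - j) * (l * l + l * j - j * j))"
    using \<open>0 < j\<close> by simp
  moreover have "j ^ 4 - 2 * j ^ 3 * l + 2 * j * l ^ 3
      = j * ((l - j) * (l * l + l * j - j * j)) + (j * (l * l)) * l"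
    by (simp add: power3_eq_cube power4_eq_xxxx algebra_simps)
  moreover have "1 * l \<le> (j * (l * l)) * l"
    using \<open>0 < j\<close> assms(2) by (intro mult_right_mono) (simp_all add: int_one_le_iff_zero_less)
  ultimately show ?thesis by linarith
qed

lemma h44_eq_4:
  assumes "h44 p q = 4" "q \<le> p" "0 < q"
  shows "p = q"
proof (rule ccontr)
  assume "p \<noteq> q"
  then have "2 \<le> p" "1 \<le> q" using assms by linarith+
  then have "2 * (2 * 2) \<le> p * (p * p)" "q * (q * q) \<le> p * (q * q)"
    using assms by (intro mult_mono; simp)+
  moreover have "0 \<le> p * (p * q)" "0 \<le> p * (q * q)"
    using assms by simp_all
  moreover have "h44 p q = p * (p * p) + p * (p * q) + 3 * (p * (q * q)) - q * (q * q)"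
    by (simp add: h44_def power2_eq_square power3_eq_cube)
  ultimately show False
    using assms(1) by linarith
qed

lemma X44_trivial_or_ge:
  assumes X: "X44 x e" and smaller: "\<And>x' e'. X44 x' e' \<Longrightarrow> e' < e \<Longrightarrow> x' = e'\<^sup>2"
  obtains "x = e\<^sup>2"
    | x' where "e\<^sup>2 \<le> x" "h44 x' (e\<^sup>2) = 4" "X44 x' e" "x' = e\<^sup>2 \<Longrightarrow> x = e\<^sup>2"
proof -
  obtain j l k x' e' where jl: "0 < l" "coprime j l" and e: "e\<^sup>2 = k\<^sup>2 * l * c44 j l"
    and x: "x = k\<^sup>2 * (j ^ 4 - 2 * j ^ 3 * l + 2 * j * l ^ 3)"
    and x': "X44 x' e'" "x' = e'\<^sup>2 \<Longrightarrow> j = l"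
    and e': "e' < e \<or> e' = e \<and> k\<^sup>2 = 1 \<and> c44 j l = 1 \<and> l = e\<^sup>2 \<and> x' = 2 * j - l"
    by (rule X44_descent[OF X]) blast
  have trivial: "x = e\<^sup>2" if "x' = e'\<^sup>2"
  proof -
    have "j = l"
      using x'(2) that .
    then have "l = 1"
      using jl by simp
    then show ?thesis
      using e x \<open>j = l\<close> by (simp add: c44_def)
  qed
  from e' show ?thesis
  proof
    assume "e' < e"
    then show ?thesis
      using that(1) trivial smaller x'(1) by blast
  next
    assume *: "e' = e \<and> k\<^sup>2 = 1 \<and> c44 j l = 1 \<and> l = e\<^sup>2 \<and> x' = 2 * j - l"
    then have "k\<^sup>2 = 1" "c44 j l = 1" "l = e\<^sup>2"
      by auto
    then have "e\<^sup>2 \<le> x"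
      using c44_eq_1[OF _ jl(1), of j] unfolding x by (simp only: mult_1)
    moreover have "h44 x' (e\<^sup>2) = 4"
      using * h44_odd[of j l] by (metis mult.right_neutral)
    ultimately show ?thesis
      using that(2)[of x'] x'(1) trivial * by simp
  qed
qed

lemma X44_eq:
  assumes "X44 x e"
  shows "x = e\<^sup>2"
  using assms
proof (induction "nat e" arbitrary: x e rule: less_induct)
  case less
  have smaller: "x' = e'\<^sup>2" if "X44 x' e'" "e' < e" for x' e'
    using less.hyps[of e' x'] that by (auto simp: X44_def)
  have "0 < e\<^sup>2"
    using less.prems by (simp add: X44_def)
  consider "x = e\<^sup>2"
    | x' where "h44 x' (e\<^sup>2) = 4" "X44 x' e" "x' = e\<^sup>2 \<Longrightarrow> x = e\<^sup>2"
    by (rule X44_trivial_or_ge[OF less.prems smaller]) blast+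
  then show ?case
  proof cases
    case (2 x')
    \<comment> \<open>Halving again puts \<open>x'\<close> at or above \<open>e^2\<close>, where
      \<open>h44 x' (e^2) = 4\<close> has only the trivial solution.\<close>
    consider "x' = e\<^sup>2" | "e\<^sup>2 \<le> x'"
      by (rule X44_trivial_or_ge[OF 2(2) smaller]) blast+
    then show ?thesis
      using 2 h44_eq_4[OF 2(1)] \<open>0 < e\<^sup>2\<close> by cases auto
  qed
qed

lemma curve44_integer_solutions:
  assumes "coprime p q" "0 < q" "q * h44 p q = r\<^sup>2"
  shows "p = q"
proof -
  obtain e m where "0 < e" "0 < m" "q = e\<^sup>2" "h44 p q = m\<^sup>2"
    by (rule curve44_numeric[OF assms])
  then show ?thesis
    using X44_eq[OF X44I[OF assms(1)]] by simp
qed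

section \<open>Points over quadratic fields\<close>

lemma rat_square_eq_of_int:
  fixes z :: rat
  assumes "z\<^sup>2 = of_int n"
  obtains r where "n = r\<^sup>2"
proof -
  obtain a b where ab: "quotient_of z = (a, b)" by force
  have b: "0 < b" and z: "z = of_int a / of_int b"
    using quotient_of_denom_pos[OF ab] quotient_of_div[OF ab] by auto
  have "(of_int (b\<^sup>2 * n) :: rat) = of_int (a\<^sup>2)"
    using assms b by (simp add: z field_simps power2_eq_square)
  then have "b\<^sup>2 * n = a\<^sup>2"
    by (simp only: of_int_eq_iff)
  then show ?thesis
    using dvd_of_square_mult b that by (metis less_irrefl)
qed

lemma curve11_rat_solutions:
  fixes x y :: rat
  assumes "y\<^sup>2 = 2 * (x ^ 3 + x\<^sup>2 - x + 1)"
  shows "x = 1 \<or> x = -1"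
proof -
  obtain p q where pq: "quotient_of x = (p, q)" by force
  have q: "0 < q" and cop: "coprime p q" and x: "x = of_int p / of_int q"
    using quotient_of_denom_pos[OF pq] quotient_of_coprime[OF pq] quotient_of_div[OF pq] by auto
  have "(y * of_int (q\<^sup>2))\<^sup>2 = of_int (2 * q * g11 p q)"
    using q unfolding power_mult_distrib assms x g11_def
    by (simp add: field_simps power2_eq_square power3_eq_cube)
  then obtain r where "2 * q * g11 p q = r\<^sup>2"
    by (rule rat_square_eq_of_int)
  then have "q = 1" "\<bar>p\<bar> = 1"
    using curve11_integer_solutions[OF cop q] by auto
  then have "p = 1 \<or> p = -1" by linarith
  then show ?thesis
    by (auto simp: x \<open>q = 1\<close>)
qed

lemma curve44_rat_solutions:
  fixes x y :: rat
  assumes "y\<^sup>2 = x ^ 3 + x\<^sup>2 + 3 * x - 1"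
  shows "x = 1"
proof -
  obtain p q where pq: "quotient_of x = (p, q)" by force
  have q: "0 < q" and cop: "coprime p q" and x: "x = of_int p / of_int q"
    using quotient_of_denom_pos[OF pq] quotient_of_coprime[OF pq] quotient_of_div[OF pq] by auto
  have "(y * of_int (q\<^sup>2))\<^sup>2 = of_int (q * h44 p q)"
    using q unfolding power_mult_distrib assms x h44_def
    by (simp add: field_simps power2_eq_square power3_eq_cube)
  then obtain r where "q * h44 p q = r\<^sup>2"
    by (rule rat_square_eq_of_int)
  then show ?thesis
    using curve44_integer_solutions[OF cop q] q by (simp add: x)
qed

lemma curve11_Rats:
  fixes x y :: "'a::field_char_0"
  assumes "x \<in> \<rat>" "y \<in> \<rat>" "y\<^sup>2 = 2 * (x ^ 3 + x\<^sup>2 - x + 1)"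
  shows "x = 1 \<or> x = -1"
proof -
  obtain x' y' where xy: "x = of_rat x'" "y = of_rat y'"
    using assms(1,2) by (auto elim!: Rats_cases)
  have "(of_rat (y'\<^sup>2) :: 'a) = of_rat (2 * (x' ^ 3 + x'\<^sup>2 - x' + 1))"
    using assms(3) by (simp add: xy of_rat_add of_rat_diff of_rat_mult of_rat_power)
  then have "x' = 1 \<or> x' = -1"
    using curve11_rat_solutions by (simp only: of_rat_eq_iff)
  then show ?thesis
    by (auto simp: xy)
qed

lemma curve44_Rats:
  fixes x y :: "'a::field_char_0"
  assumes "x \<in> \<rat>" "y \<in> \<rat>" "y\<^sup>2 = x ^ 3 + x\<^sup>2 + 3 * x - 1"
  shows "x = 1"
proof -
  obtain x' y' where xy: "x = of_rat x'" "y = of_rat y'"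
    using assms(1,2) by (auto elim!: Rats_cases)
  have "(of_rat (y'\<^sup>2) :: 'a) = of_rat (x' ^ 3 + x'\<^sup>2 + 3 * x' - 1)"
    using assms(3) by (simp add: xy of_rat_add of_rat_diff of_rat_mult of_rat_power)
  then have "x' = 1"
    using curve44_rat_solutions by (simp only: of_rat_eq_iff)
  then show ?thesis
    by (simp add: xy)
qed

text \<open>Pulls an equation back to \<open>rat\<close>, where an order is available.\<close>

lemma Rats_square_eq_of_rat:
  fixes x :: "'a::field_char_0"
  assumes "x \<in> \<rat>" "of_rat c * x\<^sup>2 = of_rat d"
  obtains r :: rat where "c * r\<^sup>2 = d"
proof -
  obtain r where r: "x = of_rat r"
    using assms(1) by (auto elim!: Rats_cases)
  have "(of_rat (c * r\<^sup>2) :: 'a) = of_rat d"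
    using assms(2) by (simp add: r of_rat_mult of_rat_power)
  then show ?thesis
    using that by (simp only: of_rat_eq_iff)
qed

lemma Rats_mult_square_neq_neg:
  fixes x :: "'a::field_char_0"
  assumes "x \<in> \<rat>" "of_rat c * x\<^sup>2 = of_rat d" "0 < c"
  shows "0 \<le> d"
  using Rats_square_eq_of_rat[OF assms(1,2)] assms(3)
  by (metis less_imp_le mult_nonneg_nonneg zero_le_power2)

lemma Rats_square_neq_2:
  fixes x :: "'a::field_char_0"
  assumes "x \<in> \<rat>"
  shows "x\<^sup>2 \<noteq> 2"
proof
  assume "x\<^sup>2 = 2"
  then obtain r :: rat where "r\<^sup>2 = of_int 2"
    using Rats_square_eq_of_rat[OF assms, of 1 2] by auto
  then obtain k where k: "(2 :: int) = k\<^sup>2"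
    by (rule rat_square_eq_of_int)
  then have "\<bar>k\<bar> < 2"
    by (intro power2_less_imp_less[of _ 2]) simp_all
  then have "k = -1 \<or> k = 0 \<or> k = 1" by linarith
  then show False
    using k by auto
qed

lemma Rats_sum_squares_eq_0:
  fixes x y :: "'a::field_char_0"
  assumes "x \<in> \<rat>" "y \<in> \<rat>" "x\<^sup>2 + y\<^sup>2 = 0"
  shows "x = 0"
proof -
  obtain x' y' where xy: "x = of_rat x'" "y = of_rat y'"
    using assms(1,2) by (auto elim!: Rats_cases)
  have "(of_rat (x'\<^sup>2 + y'\<^sup>2) :: 'a) = of_rat 0"
    using assms(3) by (simp add: xy of_rat_add of_rat_power)
  then have "x'\<^sup>2 + y'\<^sup>2 = 0"
    by (simp only: of_rat_eq_iff)
  then show ?thesis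
    by (simp add: xy sum_power2_eq_zero_iff)
qed

lemma irrational_linear_eq_0:
  fixes x :: "'a::field_char_0"
  assumes "x \<notin> \<rat>" "a \<in> \<rat>" "b \<in> \<rat>" "a + b * x = 0"
  shows "a = 0" "b = 0"
proof -
  show "b = 0"
  proof (rule ccontr)
    assume "b \<noteq> 0"
    then have "x = - a / b"
      using assms(4) by (simp add: field_simps eq_neg_iff_add_eq_0)
    then show False
      using assms by simp
  qed
  then show "a = 0"
    using assms(4) by simp
qed

section \<open>Subfields and quadratic extensions of the rationals\<close>

lemma subfield_closed:
  assumes "is_subfield K"
  shows "0 \<in> K" "1 \<in> K" "a \<in> K \<Longrightarrow> b \<in> K \<Longrightarrow> a + b \<in> K" "a \<in> K \<Longrightarrow> b \<in> K \<Longrightarrow> a * b \<in> K"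
    "a \<in> K \<Longrightarrow> - a \<in> K" "a \<in> K \<Longrightarrow> inverse a \<in> K" "a \<in> K \<Longrightarrow> b \<in> K \<Longrightarrow> a - b \<in> K"
    "a \<in> K \<Longrightarrow> a ^ n \<in> K"
proof -
  show *: "0 \<in> K" "1 \<in> K" "a \<in> K \<Longrightarrow> b \<in> K \<Longrightarrow> a + b \<in> K" "a \<in> K \<Longrightarrow> b \<in> K \<Longrightarrow> a * b \<in> K"
    "a \<in> K \<Longrightarrow> - a \<in> K" "a \<in> K \<Longrightarrow> inverse a \<in> K" for a b
    using assms by (auto simp: is_subfield_def)
  show "a \<in> K \<Longrightarrow> b \<in> K \<Longrightarrow> a - b \<in> K"
    using *(3,5) by (metis uminus_add_conv_diff add.commute)
  show "a \<in> K \<Longrightarrow> a ^ n \<in> K"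
    by (induction n) (simp_all add: *)
qed

lemma Rats_subset_subfield:
  fixes K :: "'a::field_char_0 set"
  assumes "is_subfield K"
  shows "\<rat> \<subseteq> K"
proof
  note cl = subfield_closed[OF assms]
  have nat: "of_nat n \<in> K" for n
    by (induction n) (auto simp: cl)
  have int: "of_int n \<in> K" for n
    by (cases n rule: int_cases2) (auto simp: nat cl)
  fix x :: 'a
  assume "x \<in> \<rat>"
  then obtain a b where "x = of_int a * inverse (of_int b)"
    by (auto elim!: Rats_cases' simp: divide_inverse)
  then show "x \<in> K"
    by (simp add: cl int)
qed

text \<open>
  Degree at most two: the rationals themselves are included, which settles part (1) along with the rest.
\<close>

definition quadratic_over_Rats :: "'a::field_char_0 set \<Rightarrow> bool" where
  "quadratic_over_Rats K \<longleftrightarrow>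
    is_subfield K \<and> (\<forall>x\<in>K - \<rat>. \<forall>y\<in>K. \<exists>a\<in>\<rat>. \<exists>b\<in>\<rat>. y = a + b * x)"

lemma quadratic_over_Rats_Rats: "quadratic_over_Rats \<rat>"
  by (simp add: quadratic_over_Rats_def is_subfield_def)

lemma quadratic_field_imp:
  fixes K :: "'a::field_char_0 set"
  assumes "quadratic_field K"
  shows "quadratic_over_Rats K"
proof -
  interpret vector_space "\<lambda>(q::rat) (x::'a). of_rat q * x"
    by unfold_locales (simp_all add: algebra_simps of_rat_add of_rat_mult)
  have K: "is_subfield K" and dim2: "dim K = 2"
    using assms by (simp_all add: quadratic_field_def rat_degree_def)
  obtain B where B: "K \<subseteq> span B" "card B = 2"
    using basis_exists[of K] dim2 by metis
  have "\<exists>a\<in>\<rat>. \<exists>b\<in>\<rat>. y = a + b * x" if x: "x \<in> K - \<rat>" and y: "y \<in> K" for x y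
  proof -
    have span1: "span {1} = (\<rat> :: 'a set)"
      by (auto simp: span_singleton Rats_def)
    have "x \<noteq> 1"
      using x by auto
    have indep: "independent {x, 1}"
      using x span1 \<open>x \<noteq> 1\<close> by (simp add: independent_insert)
    \<comment> \<open>Otherwise \<open>1\<close>, \<open>x\<close>, \<open>y\<close> would be three
      independent vectors in the span of two.\<close>
    have "y \<in> span {x, 1}"
    proof (rule ccontr)
      assume *: "y \<notin> span {x, 1}"
      then have "y \<notin> {x, 1}"
        using span_base by blast
      then have "independent {y, x, 1}" "card {y, x, 1} = 3"
        using * indep \<open>x \<noteq> 1\<close> by (auto simp: independent_insert)
      moreover have "{y, x, 1} \<subseteq> span B"
        using B(1) x y subfield_closed(2)[OF K] by auto
      moreover have "finite B"
        using B(2) card.infinite by fastforce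
      ultimately show False
        using independent_span_bound[of B "{y, x, 1}"] B(2) by simp
    qed
    then obtain k where "y - of_rat k * x \<in> span {1}"
      using span_breakdown_eq by blast
    then have "y = (y - of_rat k * x) + of_rat k * x" "y - of_rat k * x \<in> \<rat>"
      by (simp_all add: span1)
    then show ?thesis
      using Rats_of_rat by blast
  qed
  then show ?thesis
    using K by (auto simp: quadratic_over_Rats_def)
qed

lemma is_subfield_adjoin_sqrt:
  fixes s :: "'a::field_char_0"
  assumes "s\<^sup>2 \<in> \<rat>"
  shows "is_subfield {a + b * s | a b. a \<in> \<rat> \<and> b \<in> \<rat>}" (is "is_subfield ?S")
proof -
  have Rats: "a \<in> ?S" if "a \<in> \<rat>" for a
    using that by (intro CollectI exI[of _ a] exI[of _ 0]) simp
  have add: "x + y \<in> ?S" if xy: "x \<in> ?S" "y \<in> ?S" for x y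
  proof -
    obtain a b c d where "x = a + b * s" "y = c + d * s" "a \<in> \<rat>" "b \<in> \<rat>" "c \<in> \<rat>" "d \<in> \<rat>"
      using xy by auto
    then show ?thesis
      by (intro CollectI exI[of _ "a + c"] exI[of _ "b + d"]) (simp add: algebra_simps)
  qed
  have mult: "x * y \<in> ?S" if xy: "x \<in> ?S" "y \<in> ?S" for x y
  proof -
    obtain a b c d where "x = a + b * s" "y = c + d * s" "a \<in> \<rat>" "b \<in> \<rat>" "c \<in> \<rat>" "d \<in> \<rat>"
      using xy by auto
    then show ?thesis
      using assms
      by (intro CollectI exI[of _ "a * c + b * d * s\<^sup>2"] exI[of _ "a * d + b * c"])
        (simp add: algebra_simps power2_eq_square)
  qed
  have uminus: "- x \<in> ?S" if "x \<in> ?S" for x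
    using mult[OF Rats[of "-1"] that] by simp
  have inv: "inverse x \<in> ?S" if x: "x \<in> ?S" for x
  proof -
    obtain a b where ab: "x = a + b * s" "a \<in> \<rat>" "b \<in> \<rat>"
      using x by auto
    have norm: "x * (a - b * s) = a\<^sup>2 - b\<^sup>2 * s\<^sup>2"
      by (simp add: ab algebra_simps power2_eq_square)
    show ?thesis
    \<comment> \<open>\<open>s\<close> may be rational, so the conjugate can vanish although
      \<open>x\<close> does not; then \<open>x = 2 a\<close>.\<close>
    proof (cases "x = 0 \<or> a - b * s = 0")
      case True
      then have "x \<in> \<rat>"
        using ab by auto
      then show ?thesis
        by (intro Rats) simp
    next
      case False
      then have "inverse x = (a + (- b) * s) * inverse (a\<^sup>2 - b\<^sup>2 * s\<^sup>2)"
        unfolding norm[symmetric] by (simp add: field_simps)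
      moreover have "inverse (a\<^sup>2 - b\<^sup>2 * s\<^sup>2) \<in> \<rat>"
        using ab assms by simp
      moreover have "a + (- b) * s \<in> ?S"
        using ab(2,3) by (intro CollectI exI[of _ a] exI[of _ "- b"]) simp
      ultimately show ?thesis
        using mult Rats by simp
    qed
  qed
  show ?thesis
    unfolding is_subfield_def
    by (intro conjI ballI add mult uminus inv Rats[OF Rats_0] Rats[OF Rats_1])
qed

lemma rat_adjoin_sqrt:
  fixes s :: "'a::field_char_0"
  assumes "s\<^sup>2 \<in> \<rat>"
  shows "rat_adjoin s = {a + b * s | a b. a \<in> \<rat> \<and> b \<in> \<rat>}"
  unfolding rat_adjoin_def
proof (rule hull_unique)
  show "{s} \<subseteq> {a + b * s | a b. a \<in> \<rat> \<and> b \<in> \<rat>}"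
    by (simp, intro exI[of _ 0] exI[of _ 1]) simp
  show "is_subfield {a + b * s | a b. a \<in> \<rat> \<and> b \<in> \<rat>}"
    by (rule is_subfield_adjoin_sqrt[OF assms])
  show "{a + b * s | a b. a \<in> \<rat> \<and> b \<in> \<rat>} \<subseteq> K" if "{s} \<subseteq> K" "is_subfield K" for K
    using that(1) Rats_subset_subfield[OF that(2)] by (auto intro!: subfield_closed(3,4)[OF that(2)])
qed

lemma quadratic_over_Rats_rat_adjoin:
  fixes s :: "'a::field_char_0"
  assumes "s\<^sup>2 \<in> \<rat>"
  shows "quadratic_over_Rats (rat_adjoin s)"
proof -
  have "\<exists>a\<in>\<rat>. \<exists>b\<in>\<rat>. y = a + b * x" if x: "x \<in> rat_adjoin s - \<rat>" and y: "y \<in> rat_adjoin s" for x y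
  proof -
    obtain a b c d where abcd: "x = a + b * s" "y = c + d * s" "a \<in> \<rat>" "b \<in> \<rat>" "c \<in> \<rat>" "d \<in> \<rat>"
      using x y by (auto simp: rat_adjoin_sqrt[OF assms])
    have "b \<noteq> 0"
      using x abcd by auto
    then have "y = (c - d * a / b) + (d / b) * x"
      by (simp add: abcd field_simps)
    moreover have "c - d * a / b \<in> \<rat>" "d / b \<in> \<rat>"
      using abcd by simp_all
    ultimately show ?thesis by blast
  qed
  then show ?thesis
    using is_subfield_adjoin_sqrt[OF assms]
    by (auto simp: quadratic_over_Rats_def rat_adjoin_sqrt[OF assms])
qed

lemma quadratic_over_Rats_eq_rat_adjoin:
  assumes "quadratic_over_Rats K" "x \<in> K" "x \<notin> \<rat>" "x\<^sup>2 \<in> \<rat>"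
  shows "K = rat_adjoin x"
proof
  show "K \<subseteq> rat_adjoin x"
    using assms unfolding quadratic_over_Rats_def rat_adjoin_sqrt[OF assms(4)] by blast
  show "rat_adjoin x \<subseteq> K"
    unfolding rat_adjoin_def using assms by (intro hull_minimal) (auto simp: quadratic_over_Rats_def)
qed

text \<open>
  In the proof, \<open>t\<close> is the abscissa of the third intersection point of the line \<open>Y = a + b X\<close> with the curve;
  the other two are \<open>x\<close> and its conjugate.
\<close>

lemma third_intersection_point:
  fixes x y :: "'a::field_char_0"
  assumes x: "x \<notin> \<rat>" and uv: "u \<in> \<rat>" "v \<in> \<rat>" "x\<^sup>2 = u + v * x"
    and ab: "a \<in> \<rat>" "b \<in> \<rat>" "y = a + b * x"
    and y: "y\<^sup>2 = 2 * (x ^ 3 + x\<^sup>2 - x + 1)"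
  obtains c where "c \<in> \<rat>" "y = 2 + c * (x - 1) \<or> y = - (2 + c * (x - 1))"
      "2 * v = c\<^sup>2 - 4" "2 * u = - (2 - 4 * c + c\<^sup>2)"
    | c where "c \<in> \<rat>" "y = 2 + c * (x + 1) \<or> y = - (2 + c * (x + 1))"
      "2 * v = c\<^sup>2" "2 * u = 2 + 4 * c + c\<^sup>2"
proof -
  \<comment> \<open>The remainder modulo the minimal polynomial \<open>X^2 - v X - u\<close> of
    \<open>x\<close>; both coefficients must vanish.\<close>
  have "2 * (x ^ 3 + x\<^sup>2 - x + 1) - y\<^sup>2
    = (2 * u * v + 2 * u + 2 - a\<^sup>2 - b\<^sup>2 * u) + (2 * (u + v\<^sup>2) + 2 * v - 2 - 2 * a * b - b\<^sup>2 * v) * x"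
    unfolding ab(3) using uv(3) by algebra
  then have lin: "(2 * u * v + 2 * u + 2 - a\<^sup>2 - b\<^sup>2 * u) +
      (2 * (u + v\<^sup>2) + 2 * v - 2 - 2 * a * b - b\<^sup>2 * v) * x = 0"
    by (metis y diff_self)
  have E0: "2 * u * v + 2 * u + 2 - a\<^sup>2 - b\<^sup>2 * u = 0"
    and E1: "2 * (u + v\<^sup>2) + 2 * v - 2 - 2 * a * b - b\<^sup>2 * v = 0"
    by (rule irrational_linear_eq_0[OF x _ _ lin]; use uv ab in simp)+
  \<comment> \<open>By Vieta the three abscissae sum to \<open>(b^2 - 2) / 2\<close>, and
    \<open>x\<close> and its conjugate sum to \<open>v\<close>.\<close>
  define t where "t = (b\<^sup>2 - 2) / 2 - v"
  have t: "2 * t = b\<^sup>2 - 2 - 2 * v"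
    by (simp add: t_def field_simps)
  have "2 * (2 * (t ^ 3 + t\<^sup>2 - t + 1) - (a + b * t)\<^sup>2) = 0"
    using E0 E1 t by algebra
  then have curve: "(a + b * t)\<^sup>2 = 2 * (t ^ 3 + t\<^sup>2 - t + 1)"
    by (metis mult_eq_0_iff zero_neq_numeral right_minus_eq)
  have v: "2 * v = b\<^sup>2 - 2 - 2 * t"
    by (simp add: t)
  have u: "2 * u = 2 * v * t + 2 + 2 * a * b"
    using E1 v by algebra
  have "t \<in> \<rat>"
    using uv ab by (simp add: t_def)
  then have "t = 1 \<or> t = -1"
    using curve11_Rats[OF _ _ curve] ab by simp
  then show ?thesis
  proof
    assume "t = 1"
    \<comment> \<open>The line passes through \<open>(1, 2)\<close> or \<open>(1, -2)\<close>; in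
      the second case it is reflected, so \<open>c = - b\<close>.\<close>
    then have "(a + b)\<^sup>2 = 2\<^sup>2"
      using curve by simp
    then consider "a + b = 2" | "a + b = -2"
      using power2_eq_iff by blast
    then show ?thesis
    proof cases
      case 1
      then have a: "a = 2 - b" by (simp add: eq_diff_eq)
      show ?thesis
        by (rule that(1)[of b]; (unfold u)?; (unfold v)?)
          (use ab(2) in \<open>simp_all add: ab(3) a \<open>t = 1\<close> power2_eq_square algebra_simps\<close>)
    next
      case 2
      then have a: "a = - 2 - b" by (simp add: eq_diff_eq)
      show ?thesis
        by (rule that(1)[of "- b"]; (unfold u)?; (unfold v)?)
          (use ab(2) in \<open>simp_all add: ab(3) a \<open>t = 1\<close> power2_eq_square algebra_simps\<close>)
    qed
  next
    assume "t = -1"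
    then have "(a - b)\<^sup>2 = 2\<^sup>2"
      using curve by simp
    then consider "a - b = 2" | "a - b = -2"
      using power2_eq_iff by blast
    then show ?thesis
    proof cases
      case 1
      then have a: "a = 2 + b" by (simp add: diff_eq_eq)
      show ?thesis
        by (rule that(2)[of b]; (unfold u)?; (unfold v)?)
          (use ab(2) in \<open>simp_all add: ab(3) a \<open>t = -1\<close> power2_eq_square algebra_simps\<close>)
    next
      case 2
      then have a: "a = - 2 + b" by (simp add: diff_eq_eq)
      show ?thesis
        by (rule that(2)[of "- b"]; (unfold u)?; (unfold v)?)
          (use ab(2) in \<open>simp_all add: ab(3) a \<open>t = -1\<close> power2_eq_square algebra_simps\<close>)
    qed
  qed
qed

lemma curve_point_irrational:
  fixes x y z :: "'a::field_char_0"
  assumes K: "quadratic_over_Rats K" and xyz: "(x, y, z) \<in> curve_points K" and x: "x \<notin> \<rat>"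
  shows "x\<^sup>2 = - 7" "y \<in> {2 * x - 4, - (2 * x - 4)}" "z \<in> {2 * x + 4, - (2 * x + 4)}"
proof -
  have in_K: "x \<in> K" "y \<in> K" "z \<in> K" and y: "y\<^sup>2 = 2 * (x ^ 3 + x\<^sup>2 - x + 1)"
    and z: "z\<^sup>2 = - 2 * (x ^ 3 - x\<^sup>2 - x - 1)"
    using xyz by (auto simp: curve_points_def)
  have "x\<^sup>2 \<in> K"
    using K in_K subfield_closed(8) by (auto simp: quadratic_over_Rats_def)
  then obtain u v a b c d where uv: "u \<in> \<rat>" "v \<in> \<rat>" "x\<^sup>2 = u + v * x"
    and ab: "a \<in> \<rat>" "b \<in> \<rat>" "y = a + b * x" and cd: "c \<in> \<rat>" "d \<in> \<rat>" "z = c + d * x"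
    using K in_K x unfolding quadratic_over_Rats_def by (metis DiffI)
  have not_1: "x\<^sup>2 \<noteq> 1" "(x + 1)\<^sup>2 \<noteq> 0" "(x - 1)\<^sup>2 \<noteq> 0"
    using x by (auto simp: power2_eq_1_iff add_eq_0_iff2)
  have x': "- x \<notin> \<rat>"
    using x Rats_minus_iff by blast
  have uv': "- v \<in> \<rat>" "(- x)\<^sup>2 = u + (- v) * (- x)"
    using uv by simp_all
  have cd': "- d \<in> \<rat>" "z = c + (- d) * (- x)"
    using cd by simp_all
  \<comment> \<open>The equation for \<open>z\<close> is that for \<open>y\<close> at
    \<open>- x\<close>, whose trace is \<open>- v\<close>.\<close>
  have z': "z\<^sup>2 = 2 * ((- x) ^ 3 + (- x)\<^sup>2 - (- x) + 1)"
    using z by (simp add: algebra_simps)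
  have dbl: "2 * x\<^sup>2 = 2 * u + 2 * v * x"
    by (simp add: uv(3) algebra_simps)
  define T where "T \<longleftrightarrow> x\<^sup>2 = - 7 \<and> y \<in> {2 * x - 4, - (2 * x - 4)} \<and> z \<in> {2 * x + 4, - (2 * x + 4)}"
  have T
    using x uv ab y
  proof (cases rule: third_intersection_point)
    case p: (1 p)
    from x' uv(1) uv' cd(1) cd' z' show ?thesis
    proof (cases rule: third_intersection_point)
      case q: (1 q)
      \<comment> \<open>Comparison of both values of \<open>u\<close> and of \<open>v\<close>. Over
        the four cases only \<open>p = q = -2\<close> here survives; every other solution makes
        \<open>x\<close> equal to 1 or -1.\<close>
      have "(p - q) * (4 - p - q) = 0" "p\<^sup>2 + q\<^sup>2 = 8"
        using p(3,4) q(3,4) by algebra+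
      then consider "p - q = 0" | "4 - p - q = 0"
        by (metis mult_eq_0_iff)
      then have "p - q = 0"
      proof cases
        case 2
        then have "2 * (p - 2)\<^sup>2 = 0"
          using \<open>p\<^sup>2 + q\<^sup>2 = 8\<close> by algebra
        then have "p = 2" by simp
        then show ?thesis using 2 by simp
      qed
      then have pq: "p = q" by simp
      then have "2 * p\<^sup>2 = 2 * 2\<^sup>2"
        using \<open>p\<^sup>2 + q\<^sup>2 = 8\<close> by simp
      then consider "p = 2" | "p = -2"
        using power2_eq_iff[of p 2] by (metis mult_left_cancel zero_neq_numeral)
      then show ?thesis
      proof cases
        case 1
        then have "2 * x\<^sup>2 = 2 * 1"
          unfolding dbl p(3,4) by simp
        then show ?thesis using not_1 by simp
      next
        case 2
        then have "2 * x\<^sup>2 = 2 * -7"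
          unfolding dbl p(3,4) by simp
        then have "x\<^sup>2 = -7"
          by (metis mult_left_cancel zero_neq_numeral)
        moreover have "y \<in> {2 * x - 4, - (2 * x - 4)}"
          using p(2) 2 by (auto simp: algebra_simps)
        moreover have "z \<in> {2 * x + 4, - (2 * x + 4)}"
          using q(2) 2 pq[symmetric] by (auto simp: algebra_simps)
        ultimately show ?thesis by (simp add: T_def)
      qed
    next
      case q: (2 q)
      have "q = p - 2" "p * (p - 2) = 0"
        using p(3,4) q(3,4) by algebra+
      then consider "p = 0" | "p = 2" by auto
      then show ?thesis
      proof cases
        case 1
        have "2 * (x + 1)\<^sup>2 = 2 * x\<^sup>2 + 4 * x + 2"
          by (simp add: power2_eq_square algebra_simps)
        also have "\<dots> = 0"
          unfolding dbl p(3,4) 1 by simp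
        finally show ?thesis using not_1 by simp
      next
        case 2
        then have "2 * x\<^sup>2 = 2 * 1"
          unfolding dbl p(3,4) by simp
        then show ?thesis using not_1 by simp
      qed
    qed
  next
    case p: (2 p)
    from x' uv(1) uv' cd(1) cd' z' show ?thesis
    proof (cases rule: third_intersection_point)
      case q: (1 q)
      have "q = p + 2" "p * (p + 2) = 0"
        using p(3,4) q(3,4) by algebra+
      then consider "p = -2" | "p = 0" by (auto simp: eq_neg_iff_add_eq_0)
      then show ?thesis
      proof cases
        case 1
        have "2 * (x - 1)\<^sup>2 = 2 * x\<^sup>2 - 4 * x + 2"
          by (simp add: power2_eq_square algebra_simps)
        also have "\<dots> = 0"
          unfolding dbl p(3,4) 1 by simp
        finally show ?thesis using not_1 by simp
      next
        case 2
        then have "2 * x\<^sup>2 = 2 * 1"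
          unfolding dbl p(3,4) by simp
        then show ?thesis using not_1 by simp
      qed
    next
      case q: (2 q)
      have "p\<^sup>2 + q\<^sup>2 = 0"
        using p(3) q(3) by algebra
      then have "p = 0"
        using Rats_sum_squares_eq_0 p(1) q(1) by blast
      then have "2 * x\<^sup>2 = 2 * 1"
        unfolding dbl p(3,4) by simp
      then show ?thesis using not_1 by simp
    qed
  qed
  then show "x\<^sup>2 = - 7" "y \<in> {2 * x - 4, - (2 * x - 4)}" "z \<in> {2 * x + 4, - (2 * x + 4)}"
    by (auto simp: T_def)
qed

lemma curve_point_rational:
  fixes x y z :: "'a::field_char_0"
  assumes K: "quadratic_over_Rats K" and xyz: "(x, y, z) \<in> curve_points K" and x: "x \<in> \<rat>"
  shows "(x, y, z) \<in> {1, -1} \<times> {2, -2} \<times> {2, -2} \<or> x = 0 \<and> y\<^sup>2 = 2 \<and> z\<^sup>2 = 2"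
proof -
  have in_K: "y \<in> K" "z \<in> K" and y: "y\<^sup>2 = 2 * (x ^ 3 + x\<^sup>2 - x + 1)"
    and z: "z\<^sup>2 = - 2 * (x ^ 3 - x\<^sup>2 - x - 1)"
    using xyz by (auto simp: curve_points_def)
  have z': "z\<^sup>2 = 2 * ((- x) ^ 3 + (- x)\<^sup>2 - (- x) + 1)"
    using z by (simp add: algebra_simps)
  have trivial: ?thesis if "x = 1 \<or> x = -1"
  proof -
    have "y\<^sup>2 = 2\<^sup>2" "z\<^sup>2 = 2\<^sup>2"
      using that y z by auto
    then show ?thesis
      using that unfolding power2_eq_iff by auto
  qed
  consider "y \<in> \<rat>" | "z \<in> \<rat>" | "y \<notin> \<rat>" "z \<notin> \<rat>" by blast
  then show ?thesis
  proof cases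
    case 1
    then show ?thesis
      using trivial curve11_Rats[OF x _ y] by blast
  next
    case 2
    then have "- x = 1 \<or> - x = -1"
      using curve11_Rats[OF _ _ z'] x by simp
    then have "x = 1 \<or> x = -1"
      by (metis minus_minus)
    then show ?thesis
      by (rule trivial)
  next
    case 3
    obtain a b where ab: "a \<in> \<rat>" "b \<in> \<rat>" "z = a + b * y"
      using K in_K 3 unfolding quadratic_over_Rats_def by (metis DiffI)
    \<comment> \<open>\<open>y^2\<close> and \<open>z^2\<close> are rational, so the coefficient of
      \<open>y\<close> vanishes; \<open>b = 0\<close> would make \<open>z\<close> rational.\<close>
    have lin: "(a\<^sup>2 + b\<^sup>2 * y\<^sup>2 - z\<^sup>2) + (2 * a * b) * y = 0"
      unfolding ab(3) by (simp add: power2_eq_square algebra_simps)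
    have "2 * a * b = 0"
      by (rule irrational_linear_eq_0(2)[OF 3(1) _ _ lin]) (use x ab(1,2) in \<open>simp_all add: y z\<close>)
    then have "a = 0"
      using 3(2) ab by auto
    show ?thesis
    proof (cases "x = 0")
      case True
      then show ?thesis
        using y z by simp
    next
      case False
      \<comment> \<open>Since \<open>z = b y\<close>, this is \<open>y z / 2\<close>; division by
        \<open>x^3\<close> gives the ordinate above \<open>1 / x^2\<close>.\<close>
      define w where "w = b * (x ^ 3 + x\<^sup>2 - x + 1)"
      have "z\<^sup>2 = b\<^sup>2 * y\<^sup>2"
        using ab(3) \<open>a = 0\<close> by (simp add: power_mult_distrib)
      then have "2 * (w\<^sup>2) = 2 * (- (x ^ 6) + 3 * x ^ 4 + x\<^sup>2 + 1)"
        unfolding w_def y z by algebra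
      then have w: "w\<^sup>2 = - (x ^ 6) + 3 * x ^ 4 + x\<^sup>2 + 1"
        by (metis mult_left_cancel zero_neq_numeral)
      have "(w / x ^ 3)\<^sup>2 = (1 / x\<^sup>2) ^ 3 + (1 / x\<^sup>2)\<^sup>2 + 3 * (1 / x\<^sup>2) - 1"
        using False unfolding power_divide w by (simp add: field_simps power_mult[symmetric] flip: power_add)
      then have "1 / x\<^sup>2 = 1"
        by (rule curve44_Rats[rotated 2]) (use x ab in \<open>simp_all add: w_def\<close>)
      then have "x\<^sup>2 = 1"
        by simp
      then have "x = 1 \<or> x = -1"
        by (simp add: power2_eq_1_iff)
      then show ?thesis
        by (rule trivial)
    qed
  qed
qed

theorem theorem3p25:
  shows "curve_points (\<rat> :: 'a::field_char_0 set) = {1, -1} \<times> {2, -2} \<times> {2, -2} \<and>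
    (\<forall>K :: 'a set. quadratic_field K \<and>
        \<not> (\<exists>s. s\<^sup>2 = 2 \<and> K = rat_adjoin s) \<and>
        \<not> (\<exists>s. s\<^sup>2 = - 7 \<and> K = rat_adjoin s) \<longrightarrow>
        curve_points K = curve_points \<rat>) \<and>
    (\<forall>s :: 'a. s\<^sup>2 = 2 \<longrightarrow>
        curve_points (rat_adjoin s) - curve_points \<rat> = {0} \<times> {s, -s} \<times> {s, -s}) \<and>
    (\<forall>s :: 'a. s\<^sup>2 = - 7 \<longrightarrow>
        curve_points (rat_adjoin s) - curve_points \<rat> =
          {(x, y, z). x \<in> rat_adjoin s \<and> x\<^sup>2 + 7 = 0 \<and>
             y \<in> {2 * x - 4, - (2 * x - 4)} \<and> z \<in> {2 * x + 4, - (2 * x + 4)}})"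
proof -
  define E :: "('a \<times> 'a \<times> 'a) set" where "E = {1, -1} \<times> {2, -2} \<times> {2, -2}"
  have rational: "curve_points (\<rat> :: 'a set) = E"
  proof (rule equalityI)
    show "E \<subseteq> curve_points \<rat>"
      by (auto simp: E_def curve_points_def)
    show "curve_points \<rat> \<subseteq> E"
    proof
      fix w :: "'a \<times> 'a \<times> 'a"
      assume w: "w \<in> curve_points \<rat>"
      obtain x y z where xyz: "w = (x, y, z)" by (cases w)
      then have "x \<in> \<rat>" "y \<in> \<rat>"
        using w by (auto simp: curve_points_def)
      then show "w \<in> E"
        using curve_point_rational[OF quadratic_over_Rats_Rats] w Rats_square_neq_2
        unfolding xyz E_def by blast
    qed
  qed
  have E_sub: "E \<subseteq> curve_points K" if "quadratic_over_Rats K" for K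
  proof -
    have "curve_points \<rat> \<subseteq> curve_points K"
      using Rats_subset_subfield[of K] that by (auto simp: quadratic_over_Rats_def curve_points_def)
    then show ?thesis
      by (simp add: rational)
  qed
  have other: "x = 0 \<and> y\<^sup>2 = 2 \<and> z\<^sup>2 = 2 \<or> x \<notin> \<rat> \<and> x\<^sup>2 = - 7 \<and>
      y \<in> {2 * x - 4, - (2 * x - 4)} \<and> z \<in> {2 * x + 4, - (2 * x + 4)}"
    if "quadratic_over_Rats K" "(x, y, z) \<in> curve_points K" "(x, y, z) \<notin> E" for K x y z
    using curve_point_rational[OF that(1,2)] curve_point_irrational[OF that(1,2)] that(3)
    unfolding E_def by blast
  have generic: "curve_points K = curve_points \<rat>"
    if K: "quadratic_field K" "\<not> (\<exists>s. s\<^sup>2 = 2 \<and> K = rat_adjoin s)" "\<not> (\<exists>s. s\<^sup>2 = - 7 \<and> K = rat_adjoin s)"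
    for K :: "'a set"
  proof -
    note quad = quadratic_field_imp[OF K(1)]
    have "w \<in> E" if w: "w \<in> curve_points K" for w
    proof (rule ccontr)
      assume "w \<notin> E"
      obtain x y z where xyz: "w = (x, y, z)" by (cases w)
      have in_K: "x \<in> K" "y \<in> K"
        using w by (auto simp: xyz curve_points_def)
      from other[OF quad] w \<open>w \<notin> E\<close>
      have "y\<^sup>2 = 2 \<or> x \<notin> \<rat> \<and> x\<^sup>2 = - 7"
        unfolding xyz by blast
      then show False
      proof
        assume y: "y\<^sup>2 = 2"
        then have "y \<notin> \<rat>" "y\<^sup>2 \<in> \<rat>"
          using Rats_square_neq_2 by auto
        then show False
          using quadratic_over_Rats_eq_rat_adjoin[OF quad in_K(2)] K(2) y by blast
      next
        assume x: "x \<notin> \<rat> \<and> x\<^sup>2 = - 7"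
        then have "x\<^sup>2 \<in> \<rat>"
          by simp
        then show False
          using quadratic_over_Rats_eq_rat_adjoin[OF quad in_K(1)] K(3) x by blast
      qed
    qed
    then show ?thesis
      using E_sub[OF quad] rational by blast
  qed
  have sqrt2: "curve_points (rat_adjoin s) - curve_points \<rat> = {0} \<times> {s, -s} \<times> {s, -s}"
    if s: "s\<^sup>2 = 2" for s :: 'a
  proof (rule equalityI)
    have s2: "s\<^sup>2 \<in> \<rat>"
      by (simp add: s)
    note quad = quadratic_over_Rats_rat_adjoin[OF s2]
    have "s \<in> rat_adjoin s" "0 \<in> rat_adjoin s" "- s \<in> rat_adjoin s"
      using quad by (auto simp: quadratic_over_Rats_def rat_adjoin_def hull_inc intro: subfield_closed)
    then show "{0} \<times> {s, -s} \<times> {s, -s} \<subseteq> curve_points (rat_adjoin s) - curve_points \<rat>"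
      using s unfolding rational by (auto simp: curve_points_def E_def)
    show "curve_points (rat_adjoin s) - curve_points \<rat> \<subseteq> {0} \<times> {s, -s} \<times> {s, -s}"
    proof
      fix w assume w: "w \<in> curve_points (rat_adjoin s) - curve_points \<rat>"
      obtain x y z where xyz: "w = (x, y, z)" by (cases w)
      \<comment> \<open>If \<open>x = a + b s\<close>, then \<open>a\<close> or \<open>b\<close>
        vanishes, and \<open>2 b^2\<close> or \<open>a^2\<close> would equal -7.\<close>
      have "x\<^sup>2 \<noteq> - 7"
      proof
        assume x: "x\<^sup>2 = - 7"
        have "x \<in> rat_adjoin s"
          using w by (simp add: xyz curve_points_def)
        then obtain a b where ab: "x = a + b * s" "a \<in> \<rat>" "b \<in> \<rat>"
          by (auto simp: rat_adjoin_sqrt[OF s2])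
        have lin: "(a\<^sup>2 + 2 * b\<^sup>2 + 7) + (2 * a * b) * s = 0"
          using x s unfolding ab(1) by algebra
        have "2 * a * b = 0" and eq: "a\<^sup>2 + 2 * b\<^sup>2 + 7 = 0"
          using irrational_linear_eq_0[OF _ _ _ lin] s Rats_square_neq_2 ab(2,3) by auto
        then have "a = 0 \<or> b = 0" by simp
        then have "of_rat 2 * b\<^sup>2 = of_rat (-7) \<or> of_rat 1 * a\<^sup>2 = of_rat (-7)"
          using eq by (auto simp: eq_neg_iff_add_eq_0)
        then show False
          using Rats_mult_square_neq_neg[OF ab(2), of 1 "-7"] Rats_mult_square_neq_neg[OF ab(3), of 2 "-7"]
          by auto
      qed
      then have "x = 0 \<and> y\<^sup>2 = s\<^sup>2 \<and> z\<^sup>2 = s\<^sup>2"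
        using other[OF quad, of x y z] w s unfolding xyz rational by auto
      then show "w \<in> {0} \<times> {s, -s} \<times> {s, -s}"
        by (auto simp: xyz power2_eq_iff)
    qed
  qed
  have sqrt_minus_7: "curve_points (rat_adjoin s) - curve_points \<rat> =
      {(x, y, z). x \<in> rat_adjoin s \<and> x\<^sup>2 + 7 = 0 \<and>
        y \<in> {2 * x - 4, - (2 * x - 4)} \<and> z \<in> {2 * x + 4, - (2 * x + 4)}}" (is "_ = ?R")
    if s: "s\<^sup>2 = - 7" for s :: 'a
  proof (rule equalityI)
    have s2: "s\<^sup>2 \<in> \<rat>"
      by (simp add: s)
    note quad = quadratic_over_Rats_rat_adjoin[OF s2]
    then have sub: "is_subfield (rat_adjoin s)"
      by (simp add: quadratic_over_Rats_def)
    note cl = subfield_closed[OF sub] subsetD[OF Rats_subset_subfield[OF sub]]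
    show "?R \<subseteq> curve_points (rat_adjoin s) - curve_points \<rat>"
    proof
      fix w assume "w \<in> ?R"
      then obtain x y z where xyz: "w = (x, y, z)" and x: "x \<in> rat_adjoin s" "x\<^sup>2 + 7 = 0"
        and y: "y \<in> {2 * x - 4, - (2 * x - 4)}" and z: "z \<in> {2 * x + 4, - (2 * x + 4)}"
        by auto
      have lin: "2 * x - 4 \<in> rat_adjoin s" "2 * x + 4 \<in> rat_adjoin s"
        using x(1) by (auto intro!: cl(3,4,7) intro: cl(9))
      then have in_K: "y \<in> rat_adjoin s" "z \<in> rat_adjoin s"
        using y z lin[THEN cl(5)] by blast+
      have "y\<^sup>2 = (2 * x - 4)\<^sup>2" "z\<^sup>2 = (2 * x + 4)\<^sup>2"
        using y z by (auto simp: power2_eq_iff)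
      then have "y\<^sup>2 = 2 * (x ^ 3 + x\<^sup>2 - x + 1)" "z\<^sup>2 = - 2 * (x ^ 3 - x\<^sup>2 - x - 1)"
        using x(2) by algebra+
      moreover have "w \<notin> E"
        using x(2) by (auto simp: xyz E_def)
      ultimately show "w \<in> curve_points (rat_adjoin s) - curve_points \<rat>"
        using x(1) in_K unfolding rational by (simp add: curve_points_def xyz)
    qed
    show "curve_points (rat_adjoin s) - curve_points \<rat> \<subseteq> ?R"
    proof
      fix w assume w: "w \<in> curve_points (rat_adjoin s) - curve_points \<rat>"
      obtain x y z where xyz: "w = (x, y, z)" by (cases w)
      have in_K: "x \<in> rat_adjoin s" "y \<in> rat_adjoin s"
        using w by (auto simp: xyz curve_points_def)
      \<comment> \<open>If \<open>y = a + b s\<close>, then \<open>a\<close> or \<open>b\<close>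
        vanishes, leaving \<open>7 b^2 = -2\<close> or \<open>a^2 = 2\<close>.\<close>
      have "y\<^sup>2 \<noteq> 2"
      proof
        assume y: "y\<^sup>2 = 2"
        obtain a b where ab: "y = a + b * s" "a \<in> \<rat>" "b \<in> \<rat>"
          using in_K(2) by (auto simp: rat_adjoin_sqrt[OF s2])
        have lin: "(a\<^sup>2 - 7 * b\<^sup>2 - 2) + (2 * a * b) * s = 0"
        proof -
          have "y\<^sup>2 = a\<^sup>2 + b\<^sup>2 * s\<^sup>2 + 2 * a * b * s"
            by (simp add: ab(1) power2_eq_square algebra_simps)
          then show ?thesis
            by (simp add: y s algebra_simps)
        qed
        have "s \<notin> \<rat>"
          using Rats_mult_square_neq_neg[of s 1 "-7"] s by auto
        then have "2 * a * b = 0" and eq: "a\<^sup>2 - 7 * b\<^sup>2 - 2 = 0"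
          using irrational_linear_eq_0[OF _ _ _ lin] ab(2,3) by auto
        then have "a = 0 \<or> b = 0" by simp
        then have "of_rat 7 * b\<^sup>2 = of_rat (-2) \<or> a\<^sup>2 = 2"
          using eq by (auto simp: algebra_simps eq_neg_iff_add_eq_0)
        then show False
          using Rats_square_neq_2[OF ab(2)] Rats_mult_square_neq_neg[OF ab(3), of 7 "-2"] by auto
      qed
      then show "w \<in> ?R"
        using other[OF quad, of x y z] w in_K(1) unfolding xyz rational by auto
    qed
  qed
  show ?thesis
    using rational[unfolded E_def] generic sqrt2 sqrt_minus_7 by blast
qed

end
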